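(* Let $h\ge 0$ and $q>0$ be integers and let $G$ be a strongly stable, $(h,q)$-eventually time-periodic distributed system over a finite directed graph $\mathcal{G}(V,E)$ with realization $(A^{(k)}(t),B^{(k)}(t),C^{(k)}(t),D^{(k)}(t))$. Then there exist $(h,q)$-eventually time-periodic controllability generalized gramians $X_{\mathrm{eper}}^{(k)}(t)$, $X_{\mathrm{eper}}^{(ij)}(t)$ and $(h,q)$-eventually time-periodic observability generalized gramians $Y_{\mathrm{eper}}^{(k)}(t)$, $Y_{\mathrm{eper}}^{(ij)}(t)$, $(t,k)\in\mathbb{N}_0\times V$, $(i,j)\in E$. That is, there exist uniformly bounded, positive definite, $(h,q)$-eventually time-periodic matrix sequences and a scalar $\beta>0$ such that all these matrices are $\succ\beta I$ and, for all $(t,k)\in\mathbb{N}_0\times V$, (dropping the subscript $\mathrm{eper}$) $$A^{(k)}(t)\begin{bmatrix} X^{(k)}(t)&0 \\ 0&X_{\mathrm{in}}^{(k)}(t)\end{bmatrix}A^{(k)}(t)^T-\begin{bmatrix} X^{(k)}(t+1)&0 \\ 0&X_{\mathrm{out}}^{(k)}(t+1)\end{bmatrix}+B^{(k)}(t)B^{(k)}(t)^T\prec-\beta I,$$ $$A^{(k)}(t)^T\begin{bmatrix} Y^{(k)}(t+1)&0 \\ 0&Y_{\mathrm{out}}^{(k)}(t+1)\end{bmatrix}A^{(k)}(t)-\begin{bmatrix} Y^{(k)}(t)&0 \\ 0&Y_{\mathrm{in}}^{(k)}(t)\end{bmatrix}+C^{(k)}(t)^TC^{(k)}(t)\prec-\beta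 I.$$
   Context: **Systems.** $\mathcal{G}(V,E)$ is a finite directed graph with $V=\{1,\dots,N\}$. For $k\in V$, $E_{\mathrm{in}}^{(k)}=\{i\in V\mid (i,k)\in E\}$ and $E_{\mathrm{out}}^{(k)}=\{j\in V\mid (k,j)\in E\}$, both ordered increasingly. A distributed system $G$ has, for each $k\in V$ and $t\in\mathbb{N}_0$, a temporal state $x^{(k)}(t)\in\mathbb{R}^{n^{(k)}(t)}$, input $u^{(k)}(t)\in\mathbb{R}^{n_u^{(k)}(t)}$, output $y^{(k)}(t)\in\mathbb{R}^{n_y^{(k)}(t)}$, and for each edge $(i,j)\in E$ a spatial state $x^{(ij)}(t)\in\mathbb{R}^{n^{(ij)}(t)}$. Let $x_{\mathrm{in}}^{(k)}(t)$ be the vertical concatenation of $x^{(ik)}(t)$, $i\in E_{\mathrm{in}}^{(k)}$, and $x_{\mathrm{out}}^{(k)}(t)$ the vertical concatenation of $x^{(kj)}(t)$, $j\in E_{\mathrm{out}}^{(k)}$. The dynamics are, with zero initial conditions, for all $(t,k)\in\mathbb{N}_0\times V$, $$\begin{bmatrix} x^{(k)}(t+1) \\ x_{\mathrm{out}}^{(k)}(t+1)\end{bmatrix}=A^{(k)}(t)\begin{bmatrix} x^{(k)}(t) \\ x_{\mathrm{in}}^{(k)}(t)\end{bmatrix}+B^{(k)}(t)u^{(k)}(t),\qquad y^{(k)}(t)=C^{(k)}(t)\begin{bmatrix} x^{(k)}(t) \\ x_{\mathrm{in}}^{(k)}(t)\end{bmatrix}+D^{(k)}(t)u^{(k)}(t),$$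 where the matrices are uniformly bounded in $t$. The quadruple $(A^{(k)}(t),B^{(k)}(t),C^{(k)}(t),D^{(k)}(t))$ is the realization of $G$. For a family $Z^{(ij)}(t)$ of matrices indexed by edges, $Z_{\mathrm{in}}^{(k)}(t)=\mathrm{diag}(Z^{(ik)}(t))_{i\in E_{\mathrm{in}}^{(k)}}$ and $Z_{\mathrm{out}}^{(k)}(t)=\mathrm{diag}(Z^{(kj)}(t))_{j\in E_{\mathrm{out}}^{(k)}}$ (block-diagonal). Matrices indexed $(k)$ at time $t$ are symmetric of size $n^{(k)}(t)$; those indexed $(ij)$ are symmetric of size $n^{(ij)}(t)$. **Strong stability.** $G$ is strongly stable if there exist $\beta>0$ and uniformly bounded positive definite $W^{(k)}(t)\succ\beta I$, $W^{(ij)}(t)\succ\beta I$ such that for all $(t,k)\in\mathbb{N}_0\times V$ $$A^{(k)}(t)^T\begin{bmatrix} W^{(k)}(t+1)&0 \\ 0&W_{\mathrm{out}}^{(k)}(t+1)\end{bmatrix}A^{(k)}(t)-\begin{bmatrix} W^{(k)}(t)&0 \\ 0&W_{\mathrm{in}}^{(k)}(t)\end{bmatrix}\prec-\beta I.$$ **Eventual periodicity.** A sequence $M(t)$, $t\in\mathbb{N}_0$, is $(h,q)$-eventually time-periodic if $M(t+h+zq)=M(t+h)$ for all $t,z\in\mathbb{N}_0$. $G$ is $(h,q)$-eventually time-periodic if all state-space matrix sequences $A^{(k)},B^{(k)},C^{(k)},D^{(k)}$, $k\in V$, are (in particular the dimensions of the signals are then periodic for $t\ge h$). *)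

theory Defs
  imports Complex_Main "Jordan_Normal_Form.Matrix"
begin

definition positive_definite :: "real mat \<Rightarrow> bool" where
  "positive_definite M \<longleftrightarrow>
     M \<in> carrier_mat (dim_row M) (dim_row M) \<and> transpose_mat M = M \<and>
     (\<forall>v \<in> carrier_vec (dim_row M). v \<noteq> 0\<^sub>v (dim_row M) \<longrightarrow> v \<bullet> (M *\<^sub>v v) > 0)"

text \<open>The strict Loewner order. The difference of two matrices takes its dimensions from the
  second argument, so equality of the dimensions has to be required separately.\<close>

definition loewner_less :: "real mat \<Rightarrow> real mat \<Rightarrow> bool" (infix "\<prec>\<^sub>L" 50) where
  "P \<prec>\<^sub>L Q \<longleftrightarrow> dim_row P = dim_row Q \<and> dim_col P = dim_col Q \<and> positive_definite (Q - P)"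

text \<open>Uniform boundedness in the operator norm induced by the Euclidean norms. Since the
  dimensions may vary with time without any bound, an entrywise bound would not be equivalent.\<close>

definition uniformly_bounded :: "(nat \<Rightarrow> real mat) \<Rightarrow> bool" where
  "uniformly_bounded M \<longleftrightarrow>
     (\<exists>c. \<forall>t. \<forall>v \<in> carrier_vec (dim_col (M t)).
        sqrt ((M t *\<^sub>v v) \<bullet> (M t *\<^sub>v v)) \<le> c * sqrt (v \<bullet> v))"

definition ev_periodic :: "nat \<Rightarrow> nat \<Rightarrow> (nat \<Rightarrow> 'a) \<Rightarrow> bool" where
  "ev_periodic h q M \<longleftrightarrow> (\<forall>t z. M (t + h + z * q) = M (t + h))"

text \<open>A system is represented by its graph on the vertices 1 to N, the signal dimensions and
  its realization. The dynamics are
    \<open>(x_k (t+1), x_out_k (t+1)) = A_k t (x_k t, x_in_k t) + B_k t u_k t\<close> and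
    \<open>y_k t = C_k t (x_k t, x_in_k t) + D_k t u_k t\<close>,
  where \<open>x_in_k\<close> and \<open>x_out_k\<close> concatenate the spatial states on the edges into and out of \<open>k\<close>.\<close>

record dist_system =
  num_verts :: nat
  edges :: "(nat \<times> nat) set"
  dim_x :: "nat \<Rightarrow> nat \<Rightarrow> nat"
  dim_e :: "nat \<times> nat \<Rightarrow> nat \<Rightarrow> nat"
  dim_u :: "nat \<Rightarrow> nat \<Rightarrow> nat"
  dim_y :: "nat \<Rightarrow> nat \<Rightarrow> nat"
  matA :: "nat \<Rightarrow> nat \<Rightarrow> real mat"
  matB :: "nat \<Rightarrow> nat \<Rightarrow> real mat"
  matC :: "nat \<Rightarrow> nat \<Rightarrow> real mat"
  matD :: "nat \<Rightarrow> nat \<Rightarrow> real mat"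

definition verts :: "dist_system \<Rightarrow> nat set" where
  "verts G = {1..num_verts G}"

definition E_in :: "dist_system \<Rightarrow> nat \<Rightarrow> nat list" where
  "E_in G k = sorted_list_of_set {i \<in> verts G. (i, k) \<in> edges G}"

definition E_out :: "dist_system \<Rightarrow> nat \<Rightarrow> nat list" where
  "E_out G k = sorted_list_of_set {j \<in> verts G. (k, j) \<in> edges G}"

text \<open>The dimensions of \<open>(x_k t, x_in_k t)\<close> and of \<open>(x_k t, x_out_k t)\<close>.\<close>

definition dim_in :: "dist_system \<Rightarrow> nat \<Rightarrow> nat \<Rightarrow> nat" where
  "dim_in G k t = dim_x G k t + (\<Sum>i \<leftarrow> E_in G k. dim_e G (i, k) t)"

definition dim_out :: "dist_system \<Rightarrow> nat \<Rightarrow> nat \<Rightarrow> nat" where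
  "dim_out G k t = dim_x G k t + (\<Sum>j \<leftarrow> E_out G k. dim_e G (k, j) t)"

definition distributed_system :: "dist_system \<Rightarrow> bool" where
  "distributed_system G \<longleftrightarrow>
     edges G \<subseteq> verts G \<times> verts G \<and>
     (\<forall>k \<in> verts G.
        (\<forall>t. matA G k t \<in> carrier_mat (dim_out G k (t + 1)) (dim_in G k t) \<and>
             matB G k t \<in> carrier_mat (dim_out G k (t + 1)) (dim_u G k t) \<and>
             matC G k t \<in> carrier_mat (dim_y G k t) (dim_in G k t) \<and>
             matD G k t \<in> carrier_mat (dim_y G k t) (dim_u G k t)) \<and>
        uniformly_bounded (matA G k) \<and> uniformly_bounded (matB G k) \<and>
        uniformly_bounded (matC G k) \<and> uniformly_bounded (matD G k))"

text \<open>The matrices \<open>A\<close>, \<open>C\<close> come partitioned according to the temporal and the spatial states.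
  Equality of the underlying unpartitioned matrices only makes the total dimensions periodic, so
  periodicity of the partition is stated explicitly; periodicity of \<open>dim_u\<close> and \<open>dim_y\<close> follows
  from that of \<open>D\<close>.\<close>

definition ev_periodic_system :: "nat \<Rightarrow> nat \<Rightarrow> dist_system \<Rightarrow> bool" where
  "ev_periodic_system h q G \<longleftrightarrow>
     (\<forall>k \<in> verts G. ev_periodic h q (matA G k) \<and> ev_periodic h q (matB G k) \<and>
        ev_periodic h q (matC G k) \<and> ev_periodic h q (matD G k) \<and>
        ev_periodic h q (dim_x G k)) \<and>
     (\<forall>e \<in> edges G. ev_periodic h q (dim_e G e))"

text \<open>The block-diagonal matrices with diagonal blocks \<open>Z_k t\<close>, \<open>Z_in_k t\<close>
  respectively \<open>Z_k t\<close>, \<open>Z_out_k t\<close>.\<close>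

definition blk_in ::
  "dist_system \<Rightarrow> (nat \<Rightarrow> nat \<Rightarrow> real mat) \<Rightarrow> (nat \<times> nat \<Rightarrow> nat \<Rightarrow> real mat) \<Rightarrow>
   nat \<Rightarrow> nat \<Rightarrow> real mat" where
  "blk_in G Z Ze k t = diag_block_mat (Z k t # map (\<lambda>i. Ze (i, k) t) (E_in G k))"

definition blk_out ::
  "dist_system \<Rightarrow> (nat \<Rightarrow> nat \<Rightarrow> real mat) \<Rightarrow> (nat \<times> nat \<Rightarrow> nat \<Rightarrow> real mat) \<Rightarrow>
   nat \<Rightarrow> nat \<Rightarrow> real mat" where
  "blk_out G Z Ze k t = diag_block_mat (Z k t # map (\<lambda>j. Ze (k, j) t) (E_out G k))"

definition bounded_pd_seq :: "real \<Rightarrow> (nat \<Rightarrow> nat) \<Rightarrow> (nat \<Rightarrow> real mat) \<Rightarrow> bool" where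
  "bounded_pd_seq \<beta> n M \<longleftrightarrow>
     uniformly_bounded M \<and>
     (\<forall>t. M t \<in> carrier_mat (n t) (n t) \<and> positive_definite (M t) \<and>
          \<beta> \<cdot>\<^sub>m 1\<^sub>m (n t) \<prec>\<^sub>L M t)"

definition bounded_pd_family ::
  "dist_system \<Rightarrow> real \<Rightarrow> (nat \<Rightarrow> nat \<Rightarrow> real mat) \<Rightarrow>
   (nat \<times> nat \<Rightarrow> nat \<Rightarrow> real mat) \<Rightarrow> bool" where
  "bounded_pd_family G \<beta> Z Ze \<longleftrightarrow>
     (\<forall>k \<in> verts G. bounded_pd_seq \<beta> (dim_x G k) (Z k)) \<and>
     (\<forall>e \<in> edges G. bounded_pd_seq \<beta> (dim_e G e) (Ze e))"

definition ev_periodic_family ::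
  "nat \<Rightarrow> nat \<Rightarrow> dist_system \<Rightarrow> (nat \<Rightarrow> nat \<Rightarrow> real mat) \<Rightarrow>
   (nat \<times> nat \<Rightarrow> nat \<Rightarrow> real mat) \<Rightarrow> bool" where
  "ev_periodic_family h q G Z Ze \<longleftrightarrow>
     (\<forall>k \<in> verts G. ev_periodic h q (Z k)) \<and> (\<forall>e \<in> edges G. ev_periodic h q (Ze e))"

definition strongly_stable :: "dist_system \<Rightarrow> bool" where
  "strongly_stable G \<longleftrightarrow>
     (\<exists>\<beta> > 0. \<exists>W We. bounded_pd_family G \<beta> W We \<and>
        (\<forall>t. \<forall>k \<in> verts G.
           transpose_mat (matA G k t) * blk_out G W We k (t + 1) * matA G k t
             - blk_in G W We k t
           \<prec>\<^sub>L (- \<beta>) \<cdot>\<^sub>m 1\<^sub>m (dim_in G k t)))"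

definition controllability_gramians ::
  "dist_system \<Rightarrow> real \<Rightarrow> (nat \<Rightarrow> nat \<Rightarrow> real mat) \<Rightarrow>
   (nat \<times> nat \<Rightarrow> nat \<Rightarrow> real mat) \<Rightarrow> bool" where
  "controllability_gramians G \<beta> X Xe \<longleftrightarrow>
     bounded_pd_family G \<beta> X Xe \<and>
     (\<forall>t. \<forall>k \<in> verts G.
        matA G k t * blk_in G X Xe k t * transpose_mat (matA G k t)
          - blk_out G X Xe k (t + 1)
          + matB G k t * transpose_mat (matB G k t)
        \<prec>\<^sub>L (- \<beta>) \<cdot>\<^sub>m 1\<^sub>m (dim_out G k (t + 1)))"

definition observability_gramians ::
  "dist_system \<Rightarrow> real \<Rightarrow> (nat \<Rightarrow> nat \<Rightarrow> real mat) \<Rightarrow>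
   (nat \<times> nat \<Rightarrow> nat \<Rightarrow> real mat) \<Rightarrow> bool" where
  "observability_gramians G \<beta> Y Ye \<longleftrightarrow>
     bounded_pd_family G \<beta> Y Ye \<and>
     (\<forall>t. \<forall>k \<in> verts G.
        transpose_mat (matA G k t) * blk_out G Y Ye k (t + 1) * matA G k t
          - blk_in G Y Ye k t
          + transpose_mat (matC G k t) * matC G k t
        \<prec>\<^sub>L (- \<beta>) \<cdot>\<^sub>m 1\<^sub>m (dim_in G k t))"

end

theory Submission
  imports Defs "Jordan_Normal_Form.Determinant"
begin

text \<open>From time \<open>h\<close> on the system is periodic, so averaging a Lyapunov solution \<open>W\<close> over \<open>m\<close>
  periods and extending periodically violates the Lyapunov inequality only at the end of a period,
  by a telescoping term \<open>O(1/m)\<close>. Since the inequality is strict, a large \<open>m\<close> absorbs this error.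
  At \<open>t = h - 1\<close>, where \<open>W\<close> itself is followed by the average, the inequality survives once the
  part before \<open>h\<close> is scaled up against the average by the ratio of the uniform bounds on \<open>W\<close>; a
  common large factor then absorbs \<open>C\<^sup>T C\<close>. The controllability inequality runs in the
  opposite time direction and is solved by \<open>W\<^sup>-\<^sup>1\<close>, which is averaged in the same way with the
  scaling reversed.\<close>

section \<open>Quadratic forms\<close>

text \<open>Gramians have to be block-diagonal along the graph. The usual series for a gramian
  couples the blocks in general, so the construction only combines the blocks of \<open>W\<close>,
  or their inverses, linearly. All blocks share the same sample times and weights; hence averaging
  the blocks and averaging the assembled matrices agree. The samples belonging to one time have the
  same phase, hence the same coefficients and the same partition, and the inequality, being affine
  in the unknown blocks, may be averaged over them.

  Strictness makes a finite average enough, so no limit of averages has to be extracted. The seam at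
  \<open>h\<close> is delicate because \<open>W\<close> there and the later average are related by
  nothing but the uniform bounds. In the observability inequality the matrix at \<open>t + 1\<close>
  has a positive sign, so a drop of the weight across the seam helps; in the controllability
  inequality the sign is negative, so a rise helps. Every inequality is tested on a fixed vector,
  which reduces it to weighted sums of real numbers.\<close>

definition qf :: "real mat \<Rightarrow> real vec \<Rightarrow> real" where
  "qf M v = v \<bullet> (M *\<^sub>v v)"

text \<open>Non-strict bounds by multiples of the identity pass through sums, block-diagonal
  assembly and inversion with constants that do not depend on the dimension. Strictness is recovered
  at the end by giving up part of the constant.\<close>

definition form_between :: "real \<Rightarrow> real \<Rightarrow> nat \<Rightarrow> real mat \<Rightarrow> bool" where
  "form_between l u n M \<longleftrightarrow> M \<in> carrier_mat n n \<and> transpose_mat M = M \<and>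
     (\<forall>v \<in> carrier_vec n. l * (v \<bullet> v) \<le> qf M v \<and> qf M v \<le> u * (v \<bullet> v))"

lemma form_betweenD:
  assumes "form_between l u n M"
  shows "M \<in> carrier_mat n n" "transpose_mat M = M"
    "v \<in> carrier_vec n \<Longrightarrow> l * (v \<bullet> v) \<le> qf M v"
    "v \<in> carrier_vec n \<Longrightarrow> qf M v \<le> u * (v \<bullet> v)"
  using assms by (auto simp: form_between_def)

lemma self_scalar_ge_0: "0 \<le> v \<bullet> (v :: real vec)"
  by (auto simp: scalar_prod_def intro!: sum_nonneg)

lemma self_scalar_pos:
  assumes "v \<in> carrier_vec n" "v \<noteq> 0\<^sub>v n"
  shows "0 < v \<bullet> (v :: real vec)"
proof -
  obtain i where i: "i < n" "v $ i \<noteq> 0"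
    using assms by (metis carrier_vecD dim_vec index_zero_vec(1) eq_vecI zero_carrier_vec)
  have "0 < (\<Sum>i<n. v $ i * v $ i)"
    using i by (intro sum_pos2[of _ i]) (auto simp: zero_less_mult_iff linorder_neq_iff)
  then show ?thesis
    using assms by (simp add: scalar_prod_def lessThan_atLeast0)
qed

lemma form_between_nonneg:
  assumes "form_between l u n M" "0 \<le> l" "v \<in> carrier_vec n"
  shows "0 \<le> qf M v"
  using form_betweenD(3)[OF assms(1,3)] mult_nonneg_nonneg[OF assms(2) self_scalar_ge_0[of v]]
  by linarith

lemma form_between_mono:
  assumes "form_between l u n M" "l' \<le> l" "u \<le> u'"
  shows "form_between l' u' n M"
  unfolding form_between_def
proof (intro conjI ballI)
  fix v :: "real vec" assume v: "v \<in> carrier_vec n"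
  show "l' * (v \<bullet> v) \<le> qf M v"
    using form_betweenD(3)[OF assms(1) v] mult_right_mono[OF assms(2) self_scalar_ge_0[of v]] by simp
  show "qf M v \<le> u' * (v \<bullet> v)"
    using form_betweenD(4)[OF assms(1) v] mult_right_mono[OF assms(3) self_scalar_ge_0[of v]] by simp
qed (use form_betweenD[OF assms(1)] in auto)

text \<open>Evaluation at the vertex gives the claim. A vanishing leading coefficient is allowed
  because a semidefinite form may vanish at a nonzero vector.\<close>

lemma discriminant_nonpos:
  fixes a b c :: real
  assumes "\<And>t. 0 \<le> a + 2 * b * t + c * t\<^sup>2" and "0 \<le> c"
  shows "b\<^sup>2 \<le> a * c"
proof (cases "c = 0")
  case True
  have "b = 0"
  proof (rule ccontr)
    assume b: "b \<noteq> 0"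
    \<comment> \<open>At this argument the polynomial, linear here, has the value
      \<open>a - (a + 1) = -1\<close>.\<close>
    have "0 \<le> a + 2 * b * (- (a + 1) / (2 * b))"
      using assms(1)[of "- (a + 1) / (2 * b)"] True by simp
    with b show False by simp
  qed
  with True show ?thesis by simp
next
  case False
  with assms(2) have c: "0 < c" by simp
  have "0 \<le> a + 2 * b * (- b / c) + c * (- b / c)\<^sup>2"
    by (rule assms(1))
  also have "\<dots> = a - b\<^sup>2 / c"
    using c by (simp add: power2_eq_square field_simps)
  finally show ?thesis
    using c by (simp add: field_simps)
qed

lemma sym_swap:
  assumes "M \<in> carrier_mat n n" "transpose_mat M = M" "v \<in> carrier_vec n" "w \<in> carrier_vec n"
  shows "w \<bullet> (M *\<^sub>v v) = v \<bullet> (M *\<^sub>v (w :: real vec))"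
  using transpose_vec_mult_scalar[OF assms(1) assms(4,3)] assms
  by (metis comm_scalar_prod mult_mat_vec_carrier)

lemma psd_Cauchy_Schwarz:
  assumes M: "M \<in> carrier_mat n n" "transpose_mat M = M"
    and psd: "\<And>v. v \<in> carrier_vec n \<Longrightarrow> 0 \<le> qf M v"
    and v: "v \<in> carrier_vec n" and w: "w \<in> carrier_vec n"
  shows "(v \<bullet> (M *\<^sub>v w))\<^sup>2 \<le> qf M v * qf M w"
proof (rule discriminant_nonpos)
  fix t :: real
  have "0 \<le> qf M (v + t \<cdot>\<^sub>v w)"
    using v w by (intro psd) auto
  also have "M *\<^sub>v (v + t \<cdot>\<^sub>v w) = M *\<^sub>v v + t \<cdot>\<^sub>v (M *\<^sub>v w)"
    using M v w by (simp add: mult_add_distrib_mat_vec[of _ n n] mult_mat_vec[of _ n n])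
  then have "qf M (v + t \<cdot>\<^sub>v w) = qf M v + 2 * (v \<bullet> (M *\<^sub>v w)) * t + qf M w * t\<^sup>2"
    using M v w sym_swap[OF M v w]
    by (simp add: qf_def add_scalar_prod_distrib[of _ n] scalar_prod_add_distrib[of _ n]
        power2_eq_square algebra_simps)
  finally show "0 \<le> qf M v + 2 * (v \<bullet> (M *\<^sub>v w)) * t + qf M w * t\<^sup>2" .
qed (use psd[OF w] in simp)

lemma Cauchy_Schwarz_vec:
  assumes "v \<in> carrier_vec n" "w \<in> carrier_vec n"
  shows "(v \<bullet> w)\<^sup>2 \<le> (v \<bullet> v) * (w \<bullet> (w :: real vec))"
  using psd_Cauchy_Schwarz[of "1\<^sub>m n" n v w] assms by (simp add: qf_def self_scalar_ge_0)

text \<open>Cauchy-Schwarz for the form of \<open>M\<close> at \<open>M v\<close> and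
  \<open>v\<close> bounds |M v|^4 by u |M v|^2 times the form at \<open>v\<close>. Cancelling |M
  v|^2 gives the claim without a spectral decomposition.\<close>

lemma norm_mult_le_form:
  assumes M: "form_between l u n M" and "0 \<le> l" and v: "v \<in> carrier_vec n"
  shows "(M *\<^sub>v v) \<bullet> (M *\<^sub>v v) \<le> u * qf M v"
proof -
  note D = form_betweenD[OF M]
  have psd: "0 \<le> qf M x" if "x \<in> carrier_vec n" for x
    using form_between_nonneg[OF M assms(2) that] .
  define y where "y = M *\<^sub>v v"
  have y: "y \<in> carrier_vec n" using D v by (simp add: y_def)
  have "(y \<bullet> y)\<^sup>2 \<le> qf M y * qf M v"
    using psd_Cauchy_Schwarz[OF D(1,2) psd y v] by (simp add: y_def)
  also have "\<dots> \<le> u * (y \<bullet> y) * qf M v"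
    by (intro mult_right_mono D(4) y psd v)
  finally have "(y \<bullet> y) * (y \<bullet> y) \<le> (y \<bullet> y) * (u * qf M v)"
    by (simp add: power2_eq_square algebra_simps)
  \<comment> \<open>For \<open>y = 0\<close> nothing can be cancelled, so the right-hand side must
    be nonnegative by itself. The sign of \<open>u\<close> is read off from the bounds on the form
    at \<open>v\<close>, unless \<open>v\<close> is zero and the form vanishes there.\<close>
  moreover have "0 \<le> u * qf M v" if "y \<bullet> y = 0"
  proof (cases "v \<bullet> v = 0")
    case True
    then show ?thesis using D(4)[OF v] psd[OF v] by simp
  next
    case False
    then have "0 < v \<bullet> v" using self_scalar_ge_0[of v] by simp
    moreover have "0 \<le> u * (v \<bullet> v)" using D(4)[OF v] psd[OF v] by simp
    ultimately have "0 \<le> u" by (simp add: zero_le_mult_iff)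
    then show ?thesis using psd[OF v] by simp
  qed
  ultimately have "y \<bullet> y \<le> u * qf M v"
    using self_scalar_ge_0[of y] by (cases "y \<bullet> y = 0") auto
  then show ?thesis by (simp add: y_def)
qed

text \<open>The lower bound excludes a kernel. With \<open>w = N v\<close>, hence
  \<open>M w = v\<close>, the form of \<open>N\<close> at \<open>v\<close> is that of
  \<open>M\<close> at \<open>w\<close>. Its lower bound is then \<open>norm_mult_le_form\<close>,
  and its upper bound comes from Cauchy-Schwarz for \<open>w\<close> and \<open>v\<close>.\<close>

lemma form_between_inverse:
  assumes M: "form_between l u n M" and l: "0 < l" and u: "0 < u"
  shows "\<exists>N. form_between (1 / u) (1 / l) n N \<and> M * N = 1\<^sub>m n"
proof -
  note D = form_betweenD[OF M]
  have "det M \<noteq> 0"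
  proof
    assume "det M = 0"
    then obtain v where v: "v \<in> carrier_vec n" "v \<noteq> 0\<^sub>v n" "M *\<^sub>v v = 0\<^sub>v n"
      using det_0_iff_vec_prod_zero_field[OF D(1)] by blast
    have "l * (v \<bullet> v) \<le> 0"
      using D(3)[OF v(1)] v by (simp add: qf_def)
    with l self_scalar_pos[OF v(1,2)] show False
      by (simp add: mult_le_0_iff)
  qed
  then obtain N where N: "N \<in> carrier_mat n n" and NM: "N * M = 1\<^sub>m n" and MN: "M * N = 1\<^sub>m n"
    using det_non_zero_imp_unit[OF D(1), of "()"] unfolding Units_def ring_mat_def by auto
  \<comment> \<open>The transpose of \<open>N\<close> is a left inverse of the symmetric
    \<open>M\<close>, hence equal to the right inverse \<open>N\<close>.\<close>
  have NtM: "transpose_mat N * M = 1\<^sub>m n"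
    using transpose_mult[OF D(1) N] D(2) MN by simp
  have "transpose_mat N = transpose_mat N * (M * N)"
    using N MN by simp
  also have "\<dots> = transpose_mat N * M * N"
    by (rule assoc_mult_mat[symmetric]) (use D(1) N in auto)
  also have "\<dots> = N" using N NtM by simp
  finally have sym: "transpose_mat N = N" .
  have "form_between (1 / u) (1 / l) n N"
    unfolding form_between_def
  proof (intro conjI ballI N sym)
    fix v :: "real vec" assume v: "v \<in> carrier_vec n"
    define w where "w = N *\<^sub>v v"
    have w: "w \<in> carrier_vec n" using N v by (simp add: w_def)
    have vw: "M *\<^sub>v w = v"
      using D(1) N v MN by (simp add: w_def assoc_mult_mat_vec[of _ n n _ n, symmetric])
    have q: "qf N v = qf M w"
      using v w comm_scalar_prod[OF v w] by (simp add: qf_def vw w_def[symmetric])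
    have "v \<bullet> v \<le> u * qf M w"
      using norm_mult_le_form[OF M _ w] l by (simp add: vw)
    then show "1 / u * (v \<bullet> v) \<le> qf N v"
      using u by (simp add: q field_simps)
    have ge: "l * (w \<bullet> w) \<le> qf M w" by (rule D(3)[OF w])
    have pos: "0 \<le> qf M w"
      using form_between_nonneg[OF M _ w] l by simp
    have "(qf M w)\<^sup>2 \<le> (w \<bullet> w) * (v \<bullet> v)"
      using Cauchy_Schwarz_vec[OF w v] by (simp add: qf_def vw)
    then have "l * (qf M w)\<^sup>2 \<le> (l * (w \<bullet> w)) * (v \<bullet> v)"
      using l by (simp add: mult.assoc)
    also have "\<dots> \<le> qf M w * (v \<bullet> v)"
      by (intro mult_right_mono ge self_scalar_ge_0)
    finally have "qf M w * (l * qf M w) \<le> qf M w * (v \<bullet> v)"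
      by (simp add: power2_eq_square algebra_simps)
    then have "l * qf M w \<le> v \<bullet> v"
      using pos self_scalar_ge_0[of v] by (cases "qf M w = 0") auto
    then show "qf N v \<le> 1 / l * (v \<bullet> v)"
      using l by (simp add: q field_simps)
  qed
  with MN show ?thesis by blast
qed

text \<open>Cauchy-Schwarz for the form of \<open>P\<close>, applied to \<open>P' v\<close> and \<open>A w\<close> with
  \<open>w = Q' A\<^sup>T v\<close>, turns the contraction \<open>A\<^sup>T P A \<le> (1 - \<beta> / u) Q\<close> into the one for the inverses.\<close>

lemma dual_Lyapunov:
  assumes A: "A \<in> carrier_mat p n"
    and P: "form_between l u p P" and Q: "form_between l u n Q"
    and P': "form_between (1 / u) (1 / l) p P'" "P * P' = 1\<^sub>m p"
    and Q': "form_between (1 / u) (1 / l) n Q'" "Q * Q' = 1\<^sub>m n"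
    and l: "0 < l" and u: "0 < u" and \<beta>: "0 < \<beta>" and "\<beta> \<le> u"
    and lyap: "\<And>w. w \<in> carrier_vec n \<Longrightarrow> qf P (A *\<^sub>v w) - qf Q w \<le> - \<beta> * (w \<bullet> w)"
    and v: "v \<in> carrier_vec p"
  shows "qf Q' (transpose_mat A *\<^sub>v v) - qf P' v \<le> - (\<beta> / u\<^sup>2) * (v \<bullet> v)"
proof -
  note PD = form_betweenD[OF P] and QD = form_betweenD[OF Q]
    and PD' = form_betweenD[OF P'(1)] and QD' = form_betweenD[OF Q'(1)]
  have psd: "0 \<le> qf P x" if "x \<in> carrier_vec p" for x
    using form_between_nonneg[OF P _ that] l by simp
  define y where "y = transpose_mat A *\<^sub>v v"
  define w where "w = Q' *\<^sub>v y"
  define x where "x = P' *\<^sub>v v"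
  have c: "y \<in> carrier_vec n" "w \<in> carrier_vec n" "x \<in> carrier_vec p" "A *\<^sub>v w \<in> carrier_vec p"
    using A QD'(1) PD'(1) v by (auto simp: y_def w_def x_def)
  have Qw: "Q *\<^sub>v w = y"
    using QD(1) QD'(1) Q'(2) c by (simp add: w_def assoc_mult_mat_vec[of _ n n _ n, symmetric])
  have Px: "P *\<^sub>v x = v"
    using PD(1) PD'(1) P'(2) v by (simp add: x_def assoc_mult_mat_vec[of _ p p _ p, symmetric])
  define s where "s = qf Q w"
  define r where "r = qf P' v"
  have s1: "qf Q' y = s"
    using comm_scalar_prod[OF c(1,2)] by (simp add: s_def qf_def Qw w_def[symmetric])
  have s2: "s = (A *\<^sub>v w) \<bullet> (P *\<^sub>v x)"
  proof -
    have "s = y \<bullet> w" using comm_scalar_prod[OF c(1,2)] by (simp add: s_def qf_def Qw)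
    also have "\<dots> = v \<bullet> (A *\<^sub>v w)"
      unfolding y_def by (rule transpose_vec_mult_scalar[OF A c(2) v])
    finally show ?thesis using comm_scalar_prod[OF v c(4)] by (simp add: Px)
  qed
  have r: "qf P x = r"
    using comm_scalar_prod[OF v c(3)] by (simp add: qf_def r_def Px x_def[symmetric])
  have r0: "0 \<le> r" using psd[OF c(3)] r by simp
  have s0: "0 \<le> s"
    using form_between_nonneg[OF Q _ c(2)] l by (simp add: s_def)
  \<comment> \<open>The absolute decrease \<beta> |w|^2 is made relative to the form of
    \<open>Q\<close>, at the price of a factor 1 / u.\<close>
  have "s \<le> u * (w \<bullet> w)" using QD(4)[OF c(2)] by (simp add: s_def)
  then have "\<beta> / u * s \<le> \<beta> * (w \<bullet> w)"
    using \<beta> u by (simp add: field_simps)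
  then have AP: "qf P (A *\<^sub>v w) \<le> (1 - \<beta> / u) * s"
    using lyap[OF c(2)] by (simp add: s_def algebra_simps)
  have "s\<^sup>2 \<le> qf P (A *\<^sub>v w) * r"
    using psd_Cauchy_Schwarz[OF PD(1,2) psd c(4,3)] s2 r by simp
  also have "\<dots> \<le> (1 - \<beta> / u) * s * r"
    by (intro mult_right_mono AP r0)
  finally have ss: "s * s \<le> s * ((1 - \<beta> / u) * r)"
    by (simp add: power2_eq_square algebra_simps)
  \<comment> \<open>Division by \<open>s\<close> leaves the case \<open>s = 0\<close>, where \<beta>
    \<le> u keeps the factor of \<open>r\<close> nonnegative.\<close>
  have "s \<le> (1 - \<beta> / u) * r"
  proof (cases "s = 0")
    case False
    then show ?thesis using ss s0 by simp
  next
    case True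
    have "0 \<le> 1 - \<beta> / u" using \<open>\<beta> \<le> u\<close> u by simp
    with True show ?thesis using r0 by simp
  qed
  then have key: "s \<le> r - \<beta> / u * r" by (simp add: left_diff_distrib)
  \<comment> \<open>The lower bound on \<open>P'\<close> turns the relative gap back into an
    absolute one; this is the second factor 1 / u of the constant.\<close>
  have "1 / u * (v \<bullet> v) \<le> r" using PD'(3)[OF v] by (simp add: r_def)
  then have "\<beta> / u * (1 / u * (v \<bullet> v)) \<le> \<beta> / u * r"
    using \<beta> u by (intro mult_left_mono) auto
  then show ?thesis
    using key s1 by (simp add: y_def r_def power2_eq_square)
qed

section \<open>The Lyapunov expressions as quadratic forms\<close>

lemma qf_add:
  assumes "M \<in> carrier_mat n n" "N \<in> carrier_mat n n" "v \<in> carrier_vec n"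
  shows "qf (M + N) v = qf M v + qf N v"
  using assms by (simp add: qf_def add_mult_distrib_mat_vec[of _ n n] scalar_prod_add_distrib[of _ n])

lemma qf_minus:
  assumes "M \<in> carrier_mat n n" "N \<in> carrier_mat n n" "v \<in> carrier_vec n"
  shows "qf (M - N) v = qf M v - qf N v"
  using assms
  by (simp add: qf_def minus_mult_distrib_mat_vec[of _ n n] scalar_prod_minus_distrib[of _ n])

lemma qf_scaled_one:
  assumes "v \<in> carrier_vec n"
  shows "qf (a \<cdot>\<^sub>m 1\<^sub>m n) v = a * (v \<bullet> v)"
proof -
  have "(a \<cdot>\<^sub>m 1\<^sub>m n) *\<^sub>v v = a \<cdot>\<^sub>v (1\<^sub>m n *\<^sub>v v)"
    using assms by (intro eq_vecI) auto
  with assms show ?thesis by (simp add: qf_def)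
qed

lemma qf_congruence:
  assumes "A \<in> carrier_mat p n" "P \<in> carrier_mat p p" "v \<in> carrier_vec n"
  shows "qf (transpose_mat A * P * A) v = qf P (A *\<^sub>v v)"
proof -
  have "(transpose_mat A * P * A) *\<^sub>v v = transpose_mat A *\<^sub>v (P *\<^sub>v (A *\<^sub>v v))"
    using assms by (simp add: assoc_mult_mat_vec[of _ n p _ p] assoc_mult_mat_vec[of _ n p _ n])
  moreover have "v \<bullet> (transpose_mat A *\<^sub>v (P *\<^sub>v (A *\<^sub>v v))) = (A *\<^sub>v v) \<bullet> (P *\<^sub>v (A *\<^sub>v v))"
    using transpose_vec_mult_scalar[of "transpose_mat A" n p "P *\<^sub>v (A *\<^sub>v v)" v] assms by simp
  ultimately show ?thesis by (simp add: qf_def)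
qed

text \<open>One formula serves both kinds of gramians: with the transposes of \<open>A\<close> and
  \<open>B\<close> in place of \<open>A\<close> and \<open>C\<close>, and the in- and out-blocks
  exchanged, it is the controllability expression.\<close>

lemma Lyapunov_expression:
  assumes A: "A \<in> carrier_mat p n" and P: "P \<in> carrier_mat p p" "transpose_mat P = P"
    and Q: "Q \<in> carrier_mat n n" "transpose_mat Q = Q"
    and C: "C \<in> carrier_mat r n"
  defines "L \<equiv> transpose_mat A * P * A - Q + transpose_mat C * C"
  shows "L \<in> carrier_mat n n" and "transpose_mat L = L"
    and "v \<in> carrier_vec n \<Longrightarrow>
      qf L v = qf P (A *\<^sub>v v) - qf Q v + (C *\<^sub>v v) \<bullet> (C *\<^sub>v v)"
proof -
  have c: "transpose_mat A * P * A \<in> carrier_mat n n" "transpose_mat C * C \<in> carrier_mat n n"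
    using A P C by auto
  show "L \<in> carrier_mat n n" using c Q by (simp add: L_def)
  have "transpose_mat (transpose_mat A * P * A) = transpose_mat A * (P * A)"
    using A P transpose_mult[of "transpose_mat A * P" n p A n]
      transpose_mult[of "transpose_mat A" n p P p] by simp
  also have "\<dots> = transpose_mat A * P * A"
    by (rule assoc_mult_mat[symmetric]) (use A P in auto)
  finally have sA: "transpose_mat (transpose_mat A * P * A) = transpose_mat A * P * A" .
  have sC: "transpose_mat (transpose_mat C * C) = transpose_mat C * C"
    using C by (simp add: transpose_mult[of _ n r _ n])
  show "transpose_mat L = L"
    using c Q sA sC transpose_add[OF minus_carrier_mat[OF Q(1)] c(2), of "transpose_mat A * P * A"]
      transpose_minus[OF c(1) Q(1)] by (simp add: L_def)
  assume v: "v \<in> carrier_vec n"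
  have "transpose_mat C * C = transpose_mat C * 1\<^sub>m r * C" using C by simp
  then have "qf (transpose_mat C * C) v = (C *\<^sub>v v) \<bullet> (C *\<^sub>v v)"
    using qf_congruence[OF C one_carrier_mat v] C v by (simp add: qf_def)
  then show "qf L v = qf P (A *\<^sub>v v) - qf Q v + (C *\<^sub>v v) \<bullet> (C *\<^sub>v v)"
    unfolding L_def qf_add[OF minus_carrier_mat[OF Q(1)] c(2) v] qf_minus[OF c(1) Q(1) v]
      qf_congruence[OF A P(1) v] by simp
qed

section \<open>The Loewner order and uniform boundedness\<close>

text \<open>The gap between \<beta> and \<gamma> supplies the strictness, since the bound on the
  form allows equality.\<close>

lemma loewner_less_negI:
  assumes M: "M \<in> carrier_mat n n" "transpose_mat M = M"
    and le: "\<And>v. v \<in> carrier_vec n \<Longrightarrow> qf M v \<le> - \<gamma> * (v \<bullet> v)" and "\<beta> < \<gamma>"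
  shows "M \<prec>\<^sub>L (- \<beta>) \<cdot>\<^sub>m 1\<^sub>m n"
proof -
  let ?I = "(- \<beta>) \<cdot>\<^sub>m 1\<^sub>m n :: real mat"
  have "transpose_mat ?I = ?I"
    by (intro eq_matI) auto
  then have "transpose_mat (?I - M) = ?I - M"
    using M by (simp add: transpose_minus[of _ n n])
  moreover have "0 < v \<bullet> ((?I - M) *\<^sub>v v)" if v: "v \<in> carrier_vec n" "v \<noteq> 0\<^sub>v n" for v
  proof -
    have "\<beta> * (v \<bullet> v) < \<gamma> * (v \<bullet> v)"
      using self_scalar_pos[OF v] \<open>\<beta> < \<gamma>\<close> by simp
    then show ?thesis
      using le[OF v(1)] qf_minus[of ?I n M v] qf_scaled_one[OF v(1), of "- \<beta>"] M v
      by (simp add: qf_def)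
  qed
  ultimately show ?thesis
    using M by (auto simp: loewner_less_def positive_definite_def)
qed

lemma loewner_less_negD:
  assumes M: "M \<in> carrier_mat n n" and less: "M \<prec>\<^sub>L (- \<beta>) \<cdot>\<^sub>m 1\<^sub>m n"
    and v: "v \<in> carrier_vec n"
  shows "qf M v \<le> - \<beta> * (v \<bullet> v)"
proof (cases "v = 0\<^sub>v n")
  case True
  then show ?thesis using M by (simp add: qf_def)
next
  case False
  let ?I = "(- \<beta>) \<cdot>\<^sub>m 1\<^sub>m n :: real mat"
  have "0 < v \<bullet> ((?I - M) *\<^sub>v v)"
    using less v False M unfolding loewner_less_def positive_definite_def by simp
  then show ?thesis
    using qf_minus[of ?I n M v] qf_scaled_one[OF v, of "- \<beta>"] M v by (simp add: qf_def)
qed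

lemma uniformly_boundedD:
  assumes "uniformly_bounded M"
  shows "\<exists>c. \<forall>t. \<forall>v \<in> carrier_vec (dim_col (M t)). (M t *\<^sub>v v) \<bullet> (M t *\<^sub>v v) \<le> c\<^sup>2 * (v \<bullet> v)"
proof -
  obtain c where c: "\<And>t v. v \<in> carrier_vec (dim_col (M t)) \<Longrightarrow>
      sqrt ((M t *\<^sub>v v) \<bullet> (M t *\<^sub>v v)) \<le> c * sqrt (v \<bullet> v)"
    using assms by (auto simp: uniformly_bounded_def)
  have "(M t *\<^sub>v v) \<bullet> (M t *\<^sub>v v) \<le> c\<^sup>2 * (v \<bullet> v)" if "v \<in> carrier_vec (dim_col (M t))" for t v
    using power_mono[OF c[OF that], of 2] self_scalar_ge_0
    by (simp add: power_mult_distrib)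
  then show ?thesis by blast
qed

lemma bounded_pd_seqD:
  assumes "bounded_pd_seq \<beta> n M"
  shows "\<exists>u. \<forall>t. form_between \<beta> u (n t) (M t)"
proof -
  from assms have ub: "uniformly_bounded M"
    and M: "\<And>t. M t \<in> carrier_mat (n t) (n t)" "\<And>t. positive_definite (M t)"
      "\<And>t. \<beta> \<cdot>\<^sub>m 1\<^sub>m (n t) \<prec>\<^sub>L M t"
    by (auto simp: bounded_pd_seq_def)
  obtain c where c: "\<And>t v. v \<in> carrier_vec (dim_col (M t)) \<Longrightarrow>
      (M t *\<^sub>v v) \<bullet> (M t *\<^sub>v v) \<le> c\<^sup>2 * (v \<bullet> v)"
    using uniformly_boundedD[OF ub] by auto
  \<comment> \<open>Cauchy-Schwarz bounds the form by |v| |M v|. The sign of \<open>c\<close> is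
    unknown, so its absolute value is the constant.\<close>
  have "form_between \<beta> \<bar>c\<bar> (n t) (M t)" for t
    unfolding form_between_def
  proof (intro conjI ballI)
    show "M t \<in> carrier_mat (n t) (n t)" by (rule M)
    show "transpose_mat (M t) = M t" using M(2)[of t] by (simp add: positive_definite_def)
    fix v :: "real vec" assume v: "v \<in> carrier_vec (n t)"
    show "\<beta> * (v \<bullet> v) \<le> qf (M t) v"
    proof (cases "v = 0\<^sub>v (n t)")
      case True
      then show ?thesis using M(1)[of t] by (simp add: qf_def)
    next
      case False
      have "0 < qf (M t - \<beta> \<cdot>\<^sub>m 1\<^sub>m (n t)) v"
        using M(3)[of t] v False M(1)[of t]
        unfolding loewner_less_def positive_definite_def qf_def by simp
      then show ?thesis
        using qf_minus[of "M t" "n t" "\<beta> \<cdot>\<^sub>m 1\<^sub>m (n t)" v] qf_scaled_one[OF v, of \<beta>] M(1)[of t] v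
        by simp
    qed
    have Mv: "M t *\<^sub>v v \<in> carrier_vec (n t)" using M(1)[of t] v by simp
    have "(qf (M t) v)\<^sup>2 \<le> (v \<bullet> v) * ((M t *\<^sub>v v) \<bullet> (M t *\<^sub>v v))"
      using Cauchy_Schwarz_vec[OF v Mv] by (simp add: qf_def)
    also have "\<dots> \<le> (v \<bullet> v) * (c\<^sup>2 * (v \<bullet> v))"
      using M(1)[of t] v by (intro mult_left_mono c self_scalar_ge_0) auto
    finally have "(qf (M t) v)\<^sup>2 \<le> (\<bar>c\<bar> * (v \<bullet> v))\<^sup>2"
      by (simp add: power2_eq_square algebra_simps)
    then show "qf (M t) v \<le> \<bar>c\<bar> * (v \<bullet> v)"
      by (rule power2_le_imp_le) (simp add: self_scalar_ge_0)
  qed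
  then show ?thesis by blast
qed

lemma bounded_pd_seqI:
  assumes M: "\<And>t. form_between l u (n t) (M t)" and \<beta>: "0 < \<beta>" "\<beta> < l" and "0 < u"
  shows "bounded_pd_seq \<beta> n M"
  unfolding bounded_pd_seq_def
proof (intro conjI allI)
  have l: "0 < l" using \<beta> by simp
  show "uniformly_bounded M"
    unfolding uniformly_bounded_def
  proof (intro exI[of _ u] allI ballI)
    fix t and v :: "real vec" assume "v \<in> carrier_vec (dim_col (M t))"
    then have v: "v \<in> carrier_vec (n t)" using form_betweenD(1)[OF M[of t]] by simp
    \<comment> \<open>Positivity is what lets a bound on the form control the operator norm.\<close>
    have "(M t *\<^sub>v v) \<bullet> (M t *\<^sub>v v) \<le> u * qf (M t) v"
      using norm_mult_le_form[OF M _ v] l by simp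
    also have "\<dots> \<le> u * (u * (v \<bullet> v))"
      using form_betweenD(4)[OF M v] \<open>0 < u\<close> by simp
    finally have "sqrt ((M t *\<^sub>v v) \<bullet> (M t *\<^sub>v v)) \<le> sqrt (u\<^sup>2 * (v \<bullet> v))"
      by (simp add: power2_eq_square algebra_simps)
    then show "sqrt ((M t *\<^sub>v v) \<bullet> (M t *\<^sub>v v)) \<le> u * sqrt (v \<bullet> v)"
      using \<open>0 < u\<close> by (simp add: real_sqrt_mult)
  qed
  fix t
  note D = form_betweenD[OF M[of t]]
  show "M t \<in> carrier_mat (n t) (n t)" by (rule D)
  have pos: "\<alpha> * (v \<bullet> v) < qf (M t) v"
    if v: "v \<in> carrier_vec (n t)" "v \<noteq> 0\<^sub>v (n t)" and "\<alpha> < l" for v \<alpha>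
    using D(3)[OF v(1)] mult_strict_right_mono[OF \<open>\<alpha> < l\<close> self_scalar_pos[OF v]] by linarith
  show "positive_definite (M t)"
    using D(1,2) pos[where \<alpha> = 0] l by (auto simp: positive_definite_def qf_def)
  let ?I = "\<beta> \<cdot>\<^sub>m 1\<^sub>m (n t) :: real mat"
  have "transpose_mat ?I = ?I"
    by (intro eq_matI) auto
  then have "transpose_mat (M t - ?I) = M t - ?I"
    using D(1,2) by (simp add: transpose_minus[of _ "n t" "n t"])
  moreover have "0 < v \<bullet> ((M t - ?I) *\<^sub>v v)" if v: "v \<in> carrier_vec (n t)" "v \<noteq> 0\<^sub>v (n t)" for v
    using pos[OF v \<beta>(2)] qf_minus[OF D(1) _ v(1), of ?I] qf_scaled_one[OF v(1), of \<beta>]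
    by (simp add: qf_def)
  ultimately show "\<beta> \<cdot>\<^sub>m 1\<^sub>m (n t) \<prec>\<^sub>L M t"
    using D(1) by (auto simp: loewner_less_def positive_definite_def)
qed

section \<open>Block-diagonal matrices and weighted sums\<close>

lemma diag_block_carrier:
  assumes "\<And>i. i \<in> set is \<Longrightarrow> F i \<in> carrier_mat (n i) (n i)"
  shows "diag_block_mat (map F is) \<in> carrier_mat (\<Sum>i \<leftarrow> is. n i) (\<Sum>i \<leftarrow> is. n i)"
  using assms by (induction "is") (auto simp: Let_def intro!: four_block_carrier_mat)

lemma diag_block_Cons:
  assumes "\<And>j. j \<in> set (i # is) \<Longrightarrow> F j \<in> carrier_mat (n j) (n j)"
  defines "m \<equiv> \<Sum>j \<leftarrow> is. n j"
  shows "diag_block_mat (map F (i # is)) =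
    four_block_mat (F i) (0\<^sub>m (n i) m) (0\<^sub>m m (n i)) (diag_block_mat (map F is))"
proof -
  have "F i \<in> carrier_mat (n i) (n i)" "diag_block_mat (map F is) \<in> carrier_mat m m"
    using diag_block_carrier[of "is" F n] assms(1) by (auto simp: m_def)
  then show ?thesis by (simp add: Let_def)
qed

text \<open>A vector splits along the first block, and both its squared length and the form are
  additive over the split. The constants therefore do not deteriorate with the number of
  blocks.\<close>

lemma diag_block_form_between:
  assumes "\<And>i. i \<in> set is \<Longrightarrow> form_between l u (n i) (F i)"
  shows "form_between l u (\<Sum>i \<leftarrow> is. n i) (diag_block_mat (map F is))"
  using assms
proof (induction "is")
  case Nil
  show ?case by (auto simp: form_between_def qf_def scalar_prod_def)
next
  case (Cons i "is")
  define D where "D = diag_block_mat (map F is)"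
  define m where "m = (\<Sum>j \<leftarrow> is. n j)"
  have eq: "diag_block_mat (map F (i # is)) =
      four_block_mat (F i) (0\<^sub>m (n i) m) (0\<^sub>m m (n i)) D"
    unfolding D_def m_def by (rule diag_block_Cons) (use Cons.prems in \<open>auto dest: form_betweenD\<close>)
  have Fi: "form_between l u (n i) (F i)" and D: "form_between l u m D"
    using Cons by (auto simp: D_def m_def)
  note FiD = form_betweenD[OF Fi] and DD = form_betweenD[OF D]
  have "form_between l u (n i + m) (four_block_mat (F i) (0\<^sub>m (n i) m) (0\<^sub>m m (n i)) D)"
    unfolding form_between_def all_vec_append
  proof (intro conjI ballI)
    show "four_block_mat (F i) (0\<^sub>m (n i) m) (0\<^sub>m m (n i)) D \<in> carrier_mat (n i + m) (n i + m)"
      using FiD DD by (intro four_block_carrier_mat) auto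
    show "transpose_mat (four_block_mat (F i) (0\<^sub>m (n i) m) (0\<^sub>m m (n i)) D) =
        four_block_mat (F i) (0\<^sub>m (n i) m) (0\<^sub>m m (n i)) D"
      using FiD DD by (subst transpose_four_block_mat[of _ "n i" "n i" _ m _ m]) auto
    fix v w :: "real vec" assume v: "v \<in> carrier_vec (n i)" and w: "w \<in> carrier_vec m"
    have n: "(v @\<^sub>v w) \<bullet> (v @\<^sub>v w) = v \<bullet> v + w \<bullet> w"
      by (rule scalar_prod_append[OF v w v w])
    have q: "qf (four_block_mat (F i) (0\<^sub>m (n i) m) (0\<^sub>m m (n i)) D) (v @\<^sub>v w) = qf (F i) v + qf D w"
      unfolding qf_def mult_mat_vec_split[OF FiD(1) DD(1) v w]
      by (rule scalar_prod_append) (use FiD DD v w in auto)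
    show "l * ((v @\<^sub>v w) \<bullet> (v @\<^sub>v w)) \<le>
        qf (four_block_mat (F i) (0\<^sub>m (n i) m) (0\<^sub>m m (n i)) D) (v @\<^sub>v w)"
      "qf (four_block_mat (F i) (0\<^sub>m (n i) m) (0\<^sub>m m (n i)) D) (v @\<^sub>v w) \<le>
        u * ((v @\<^sub>v w) \<bullet> (v @\<^sub>v w))"
      using FiD(3,4)[OF v] DD(3,4)[OF w] by (simp_all add: n q distrib_left)
  qed
  then show ?case unfolding eq by (simp add: m_def)
qed

lemma diag_block_inverse:
  assumes "\<And>i. i \<in> set is \<Longrightarrow> F i \<in> carrier_mat (n i) (n i)"
    and "\<And>i. i \<in> set is \<Longrightarrow> H i \<in> carrier_mat (n i) (n i)"
    and "\<And>i. i \<in> set is \<Longrightarrow> F i * H i = 1\<^sub>m (n i)"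
  shows "diag_block_mat (map F is) * diag_block_mat (map H is) = 1\<^sub>m (\<Sum>i \<leftarrow> is. n i)"
  using assms
proof (induction "is")
  case Nil
  show ?case by (intro eq_matI) auto
next
  case (Cons i "is")
  define m where "m = (\<Sum>j \<leftarrow> is. n j)"
  have c: "F i \<in> carrier_mat (n i) (n i)" "diag_block_mat (map F is) \<in> carrier_mat m m"
    "H i \<in> carrier_mat (n i) (n i)" "diag_block_mat (map H is) \<in> carrier_mat m m"
    using Cons.prems diag_block_carrier[of "is" F n] diag_block_carrier[of "is" H n]
    by (auto simp: m_def)
  have e: "F i * H i = 1\<^sub>m (n i)" "diag_block_mat (map F is) * diag_block_mat (map H is) = 1\<^sub>m m"
    using Cons by (auto simp: m_def)
  have b: "diag_block_mat (map F (i # is)) =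
      four_block_mat (F i) (0\<^sub>m (n i) m) (0\<^sub>m m (n i)) (diag_block_mat (map F is))"
    "diag_block_mat (map H (i # is)) =
      four_block_mat (H i) (0\<^sub>m (n i) m) (0\<^sub>m m (n i)) (diag_block_mat (map H is))"
    unfolding m_def using Cons.prems by (auto intro!: diag_block_Cons simp del: list.map)
  have "diag_block_mat (map F (i # is)) * diag_block_mat (map H (i # is)) =
      four_block_mat (1\<^sub>m (n i)) (0\<^sub>m (n i) m) (0\<^sub>m m (n i)) (1\<^sub>m m)"
    unfolding b using c e
    by (subst mult_four_block_mat[of _ "n i" "n i" _ m _ m _ _ "n i" _ m]) auto
  also have "\<dots> = 1\<^sub>m (n i + m)" by (intro eq_matI) auto
  finally show ?case by (simp add: m_def)
qed

text \<open>Summation is entrywise with a prescribed size, since matrices of different sizes share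
  no zero matrix from which a sum could start.\<close>

definition mat_sum :: "nat \<Rightarrow> real \<Rightarrow> 'a set \<Rightarrow> ('a \<Rightarrow> real mat) \<Rightarrow> real mat" where
  "mat_sum n a S F = mat n n (\<lambda>(i, j). a * (\<Sum>s \<in> S. F s $$ (i, j)))"

lemma mat_sum_carrier [simp]: "mat_sum n a S F \<in> carrier_mat n n"
  by (simp add: mat_sum_def)

lemma qf_eq_sum:
  assumes "M \<in> carrier_mat n n" "v \<in> carrier_vec n"
  shows "qf M v = (\<Sum>i<n. \<Sum>j<n. v $ i * v $ j * M $$ (i, j))"
  using assms
  by (auto simp: qf_def scalar_prod_def lessThan_atLeast0 sum_distrib_left intro!: sum.cong)

lemma qf_mat_sum:
  assumes "\<And>s. s \<in> S \<Longrightarrow> F s \<in> carrier_mat n n" "v \<in> carrier_vec n"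
  shows "qf (mat_sum n a S F) v = a * (\<Sum>s \<in> S. qf (F s) v)"
proof -
  have "qf (mat_sum n a S F) v = (\<Sum>i<n. \<Sum>j<n. \<Sum>s \<in> S. a * (v $ i * v $ j * F s $$ (i, j)))"
    using assms(2)
    by (simp add: qf_eq_sum[of _ n] mat_sum_def sum_distrib_left algebra_simps)
  also have "\<dots> = (\<Sum>i<n. \<Sum>s \<in> S. \<Sum>j<n. a * (v $ i * v $ j * F s $$ (i, j)))"
    by (intro sum.cong refl sum.swap)
  also have "\<dots> = (\<Sum>s \<in> S. \<Sum>i<n. \<Sum>j<n. a * (v $ i * v $ j * F s $$ (i, j)))"
    by (rule sum.swap)
  also have "\<dots> = a * (\<Sum>s \<in> S. qf (F s) v)"
    using assms by (simp add: qf_eq_sum[of _ n] sum_distrib_left)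
  finally show ?thesis .
qed

lemma mat_sum_form_between:
  fixes a l u :: real
  assumes F: "\<And>s. s \<in> S \<Longrightarrow> form_between l u n (F s)" and "0 \<le> a"
  shows "form_between (a * card S * l) (a * card S * u) n (mat_sum n a S F)"
  unfolding form_between_def
proof (intro conjI ballI)
  have "F s $$ (j, i) = F s $$ (i, j)" if "s \<in> S" "i < n" "j < n" for s i j
    using form_betweenD(1,2)[OF F[OF that(1)]] that index_transpose_mat(1)[of i "F s" j] by auto
  then show "transpose_mat (mat_sum n a S F) = mat_sum n a S F"
    by (intro eq_matI) (auto simp: mat_sum_def intro!: sum.cong)
  fix v :: "real vec" assume v: "v \<in> carrier_vec n"
  have q: "qf (mat_sum n a S F) v = a * (\<Sum>s \<in> S. qf (F s) v)"
    by (rule qf_mat_sum[OF form_betweenD(1)[OF F] v])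
  have "card S * (l * (v \<bullet> v)) \<le> (\<Sum>s \<in> S. qf (F s) v)"
    by (intro sum_bounded_below form_betweenD(3)[OF F v])
  from mult_left_mono[OF this \<open>0 \<le> a\<close>]
  show "a * card S * l * (v \<bullet> v) \<le> qf (mat_sum n a S F) v"
    by (simp add: q mult.assoc)
  have "(\<Sum>s \<in> S. qf (F s) v) \<le> card S * (u * (v \<bullet> v))"
    by (intro sum_bounded_above form_betweenD(4)[OF F v])
  from mult_left_mono[OF this \<open>0 \<le> a\<close>]
  show "qf (mat_sum n a S F) v \<le> a * card S * u * (v \<bullet> v)"
    by (simp add: q mult.assoc)
qed simp

text \<open>Block-diagonal assembly is linear. This is what lets an average keep the structure that
  the graph prescribes.\<close>

lemma diag_block_mat_sum:
  assumes "\<And>i s. i \<in> set is \<Longrightarrow> s \<in> S \<Longrightarrow> F i s \<in> carrier_mat (n i) (n i)"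
  shows "diag_block_mat (map (\<lambda>i. mat_sum (n i) a S (F i)) is) =
    mat_sum (\<Sum>i \<leftarrow> is. n i) a S (\<lambda>s. diag_block_mat (map (\<lambda>i. F i s) is))"
  using assms
proof (induction "is")
  case Nil
  show ?case by (intro eq_matI) (auto simp: mat_sum_def)
next
  case (Cons i "is")
  define m where "m = (\<Sum>j \<leftarrow> is. n j)"
  define D where "D = (\<lambda>s. diag_block_mat (map (\<lambda>i. F i s) is))"
  have D: "D s \<in> carrier_mat m m" if "s \<in> S" for s
    unfolding D_def m_def using Cons.prems that by (intro diag_block_carrier) auto
  have Fi: "F i s \<in> carrier_mat (n i) (n i)" if "s \<in> S" for s
    using Cons.prems that by simp
  have s: "diag_block_mat (map (\<lambda>i. F i s) (i # is)) =
      four_block_mat (F i s) (0\<^sub>m (n i) m) (0\<^sub>m m (n i)) (D s)" if "s \<in> S" for s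
    unfolding D_def m_def by (rule diag_block_Cons) (use Cons.prems that in auto)
  have IH: "diag_block_mat (map (\<lambda>i. mat_sum (n i) a S (F i)) is) = mat_sum m a S D"
    using Cons by (simp add: m_def D_def)
  have "diag_block_mat (map (\<lambda>i. mat_sum (n i) a S (F i)) (i # is)) =
      four_block_mat (mat_sum (n i) a S (F i)) (0\<^sub>m (n i) m) (0\<^sub>m m (n i)) (mat_sum m a S D)"
    using diag_block_Cons[of i "is" "\<lambda>i. mat_sum (n i) a S (F i)" n] unfolding IH m_def by simp
  also have "\<dots> = mat_sum (n i + m) a S
      (\<lambda>s. four_block_mat (F i s) (0\<^sub>m (n i) m) (0\<^sub>m m (n i)) (D s))"
  proof (intro eq_matI)
    fix r c
    assume "r < dim_row (mat_sum (n i + m) a S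
        (\<lambda>s. four_block_mat (F i s) (0\<^sub>m (n i) m) (0\<^sub>m m (n i)) (D s)))"
      and "c < dim_col (mat_sum (n i + m) a S
        (\<lambda>s. four_block_mat (F i s) (0\<^sub>m (n i) m) (0\<^sub>m m (n i)) (D s)))"
    then have rc: "r < n i + m" "c < n i + m" by (auto simp: mat_sum_def)
    have e: "four_block_mat (F i s) (0\<^sub>m (n i) m) (0\<^sub>m m (n i)) (D s) $$ (r, c) =
        (if r < n i then if c < n i then F i s $$ (r, c) else 0
         else if c < n i then 0 else D s $$ (r - n i, c - n i))" if "s \<in> S" for s
      using Fi[OF that] D[OF that] rc by auto
    show "four_block_mat (mat_sum (n i) a S (F i)) (0\<^sub>m (n i) m) (0\<^sub>m m (n i)) (mat_sum m a S D) $$ (r, c) =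
        mat_sum (n i + m) a S
          (\<lambda>s. four_block_mat (F i s) (0\<^sub>m (n i) m) (0\<^sub>m m (n i)) (D s)) $$ (r, c)"
      using rc by (auto simp: mat_sum_def e)
  qed (auto simp: mat_sum_def)
  also have "\<dots> = mat_sum (n i + m) a S (\<lambda>s. diag_block_mat (map (\<lambda>i. F i s) (i # is)))"
    unfolding mat_sum_def using s by (intro cong_mat) (auto intro!: sum.cong simp del: list.map)
  finally show ?case by (simp add: m_def)
qed

section \<open>Periodization of sequences\<close>

text \<open>From \<open>h\<close> on the set depends on \<open>t\<close> only through its phase, so
  whatever is built from it is periodic.\<close>

definition sample_times :: "nat \<Rightarrow> nat \<Rightarrow> nat \<Rightarrow> nat \<Rightarrow> nat set" where
  "sample_times h q m t =
     (if t < h then {t} else (\<lambda>z. h + (t - h) mod q + z * q) ` {..<m})"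

text \<open>The total weight is \<open>c\<close> before \<open>h\<close> and \<open>d\<close>
  afterwards; their ratio is the jump across the seam. Observability takes \<open>d\<close> below
  \<open>c\<close>, controllability the reverse.\<close>

definition sample_weight :: "nat \<Rightarrow> nat \<Rightarrow> real \<Rightarrow> real \<Rightarrow> nat \<Rightarrow> real" where
  "sample_weight h m c d t = (if t < h then c else d / real m)"

text \<open>The scalar counterpart of \<open>periodized\<close>: its value when \<open>f\<close> is
  a form evaluated at a fixed vector.\<close>

definition sample_sum ::
  "nat \<Rightarrow> nat \<Rightarrow> nat \<Rightarrow> real \<Rightarrow> real \<Rightarrow> (nat \<Rightarrow> real) \<Rightarrow> nat \<Rightarrow> real" where
  "sample_sum h q m c d f t = sample_weight h m c d t * (\<Sum>s \<in> sample_times h q m t. f s)"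

definition periodized ::
  "nat \<Rightarrow> nat \<Rightarrow> nat \<Rightarrow> real \<Rightarrow> real \<Rightarrow> (nat \<Rightarrow> nat) \<Rightarrow> (nat \<Rightarrow> real mat) \<Rightarrow> nat \<Rightarrow> real mat" where
  "periodized h q m c d n F t =
     mat_sum (n t) (sample_weight h m c d t) (sample_times h q m t) F"

text \<open>A sample either is \<open>t\<close> or differs from it by a multiple of \<open>q\<close>
  with both at least \<open>h\<close>. The successor version is there because the inequalities
  couple times \<open>t\<close> and \<open>t + 1\<close>.\<close>

lemma ev_periodic_at_sample:
  assumes "ev_periodic h q M" "s \<in> sample_times h q m t"
  shows "M s = M t" "M (Suc s) = M (Suc t)"
proof -
  have "M s = M t \<and> M (Suc s) = M (Suc t)"
  proof (cases "t < h")
    case True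
    then show ?thesis using assms(2) by (simp add: sample_times_def)
  next
    case False
    define r where "r = (t - h) mod q"
    have per: "M (x + h + z * q) = M (x + h)" for x z
      using assms(1) by (simp add: ev_periodic_def)
    have "s \<in> (\<lambda>z. h + r + z * q) ` {..<m}"
      using assms(2) False by (simp add: sample_times_def r_def)
    then obtain z where s: "s = r + h + z * q" by force
    have t: "t = r + h + ((t - h) div q) * q"
      using False by (simp add: r_def)
    have "M t = M (r + h)" "M (Suc t) = M (Suc r + h)"
      by (subst t, use per[of r] per[of "Suc r"] in simp)+
    then show ?thesis
      using s per[of r z] per[of "Suc r" z] by simp
  qed
  then show "M s = M t" "M (Suc s) = M (Suc t)" by auto
qed

lemma sample_times_sum:
  assumes "h \<le> t" "0 < q"
  shows "(\<Sum>s \<in> sample_times h q m t. f s) = (\<Sum>z<m. f (h + (t - h) mod q + z * q))"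
proof -
  have "inj_on (\<lambda>z. h + (t - h) mod q + z * q) {..<m}"
    using \<open>0 < q\<close> by (auto intro!: inj_onI)
  then show ?thesis
    using assms by (simp add: sample_times_def sum.reindex)
qed

text \<open>The number \<open>m\<close> of averaged periods cancels, which keeps the bounds on
  periodized matrices independent of it.\<close>

lemma weight_card_sample_times:
  assumes "0 < q" "0 < m"
  shows "sample_weight h m c d t * real (card (sample_times h q m t)) = (if t < h then c else d)"
proof (cases "t < h")
  case False
  then have "card (sample_times h q m t) = m"
    using sample_times_sum[of h t q "\<lambda>_. 1 :: nat" m] assms by simp
  then show ?thesis using False assms by (simp add: sample_weight_def)
qed (simp add: sample_weight_def sample_times_def)

lemma ev_periodic_periodized:
  assumes "ev_periodic h q n"
  shows "ev_periodic h q (periodized h q m c d n F)"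
proof -
  have "sample_times h q m (t + h + z * q) = sample_times h q m (t + h)" for t z
    by (simp add: sample_times_def add.commute add.left_commute)
  moreover have "sample_weight h m c d (t + h + z * q) = sample_weight h m c d (t + h)" for t z
    by (simp add: sample_weight_def)
  ultimately show ?thesis
    using assms by (simp add: ev_periodic_def periodized_def)
qed

text \<open>Advancing the averaging window by one step exchanges at most one sample for another.\<close>

lemma sample_times_shift:
  fixes g :: "nat \<Rightarrow> real"
  assumes "h \<le> t" "0 < q" "0 < m"
    and g: "\<And>s. s \<in> Suc ` sample_times h q m t \<union> sample_times h q m (Suc t) \<Longrightarrow> 0 \<le> g s \<and> g s \<le> K"
  shows "\<bar>(\<Sum>s \<in> sample_times h q m (Suc t). g s) - (\<Sum>s \<in> sample_times h q m t. g (Suc s))\<bar> \<le> K"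
proof -
  define r where "r = (t - h) mod q"
  have r': "(Suc t - h) mod q = (if Suc r = q then 0 else Suc r)"
    using \<open>h \<le> t\<close> by (simp add: r_def Suc_diff_le mod_Suc)
  have S: "(\<Sum>s \<in> sample_times h q m t. g (Suc s)) = (\<Sum>z<m. g (h + Suc r + z * q))"
    using sample_times_sum[of h t q "\<lambda>s. g (Suc s)" m] assms by (simp add: r_def)
  have S': "(\<Sum>s \<in> sample_times h q m (Suc t). g s) =
      (\<Sum>z<m. g (h + (if Suc r = q then 0 else Suc r) + z * q))"
    using sample_times_sum[of h "Suc t" q g m] assms r' by simp
  show ?thesis
  proof (cases "Suc r = q")
    case False
    \<comment> \<open>Without a wrap the shifted samples are exactly the new ones. A sample is
      exhibited only to see that \<open>K\<close> is nonnegative.\<close>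
    have "h + r \<in> sample_times h q m t"
      using assms by (auto simp: sample_times_def r_def intro!: image_eqI[of _ _ 0])
    then have "Suc (h + r) \<in> Suc ` sample_times h q m t" by blast
    then have "0 \<le> K" using g[of "Suc (h + r)"] by auto
    then show ?thesis using False by (simp add: S S')
  next
    case True
    \<comment> \<open>When the phase wraps to 0, the sums run over
      \<open>G 0, ..., G (m - 1)\<close> and \<open>G 1, ..., G m\<close>. The two surviving terms
      both lie between 0 and \<open>K\<close>, so their difference costs \<open>K\<close> and not
      \<open>2 K\<close>.\<close>
    define G where "G = (\<lambda>z. g (h + z * q))"
    have "h \<in> sample_times h q m (Suc t)"
      using assms r' True by (auto simp: sample_times_def intro!: image_eqI[of _ _ 0])
    then have G0: "0 \<le> G 0" "G 0 \<le> K" using g[of h] by (auto simp: G_def)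
    have "h + r + (m - 1) * q \<in> sample_times h q m t"
      using assms by (auto simp: sample_times_def r_def intro!: image_eqI[of _ _ "m - 1"])
    moreover have "Suc (h + r + (m - 1) * q) = h + m * q"
      using True \<open>0 < m\<close> by (cases m) auto
    ultimately have "h + m * q \<in> Suc ` sample_times h q m t" by force
    then have Gm: "0 \<le> G m" "G m \<le> K" using g[of "h + m * q"] by (auto simp: G_def)
    have "(\<Sum>z<m. G z) - (\<Sum>z<m. G (Suc z)) = G 0 - G m"
      by (simp add: sum_subtractf[symmetric] sum_lessThan_telescope')
    moreover have "(\<Sum>s \<in> sample_times h q m (Suc t). g s) = (\<Sum>z<m. G z)"
      using True by (simp add: S' G_def)
    moreover have "(\<Sum>s \<in> sample_times h q m t. g (Suc s)) = (\<Sum>z<m. G (Suc z))"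
      unfolding S True by (simp add: G_def add.assoc)
    ultimately show ?thesis using G0 Gm by simp
  qed
qed

text \<open>A decrease common to all samples is multiplied by the total weight, which is
  \<open>c\<close> or \<open>d\<close> and hence at least \<open>e\<close>.\<close>

lemma sample_sum_mono_gap:
  assumes "0 < q" "0 < m" "0 \<le> c" "0 \<le> d" "0 \<le> e" "e \<le> c" "e \<le> d" "0 \<le> \<beta>"
    and "\<And>s. s \<in> sample_times h q m t \<Longrightarrow> f s - g s \<le> - \<beta>"
  shows "sample_sum h q m c d f t - sample_sum h q m c d g t \<le> - e * \<beta>"
proof -
  have w: "0 \<le> sample_weight h m c d t" using assms by (simp add: sample_weight_def)
  have "(\<Sum>s \<in> sample_times h q m t. f s - g s) \<le> card (sample_times h q m t) * (- \<beta>)"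
    by (intro sum_bounded_above assms(9))
  from mult_left_mono[OF this w]
  have "sample_sum h q m c d f t - sample_sum h q m c d g t \<le>
      sample_weight h m c d t * card (sample_times h q m t) * (- \<beta>)"
    by (simp add: sample_sum_def sum_subtractf right_diff_distrib mult.assoc)
  also have "\<dots> = - ((if t < h then c else d) * \<beta>)"
    using weight_card_sample_times[OF assms(1,2), of h c d t] by simp
  also have "\<dots> \<le> - e * \<beta>"
    using assms by (auto intro: mult_right_mono)
  finally show ?thesis .
qed

text \<open>At \<open>t = h - 1\<close>, where the averaging sets in, the error has the right sign if the weights
  jump by at least the ratio of the bounds on the samples.\<close>

lemma sample_sum_shift_le:
  assumes "0 < q" "0 < m" "0 \<le> c" "0 \<le> d"
    and g: "\<And>s. s \<in> Suc ` sample_times h q m t \<union> sample_times h q m (Suc t) \<Longrightarrow> 0 \<le> g s \<and> g s \<le> K"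
    and jump: "\<And>s. s \<in> sample_times h q m (Suc t) \<Longrightarrow> d * g s \<le> c * g (Suc t)"
  shows "sample_sum h q m c d g (Suc t) - sample_sum h q m c d (\<lambda>s. g (Suc s)) t \<le> d / m * K"
proof -
  consider "h \<le> t" | "Suc t < h" | "Suc t = h" by linarith
  then show ?thesis
  proof cases
    case 1
    from mult_left_mono[OF abs_le_D1[OF sample_times_shift[OF 1 assms(1,2) g]], where c = "d / m"]
    show ?thesis
      using 1 assms(4) by (simp add: sample_sum_def sample_weight_def right_diff_distrib)
  next
    case 2
    have "0 \<le> K" using g[of "Suc t"] 2 by (auto simp: sample_times_def)
    then show ?thesis
      using 2 assms(4) by (simp add: sample_sum_def sample_times_def sample_weight_def)
  next
    case 3
    have "0 \<le> K" using g[of "Suc t"] 3 by (auto simp: sample_times_def)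
    \<comment> \<open>Here \<open>t\<close> still carries the single sample of weight
      \<open>c\<close>. By \<open>jump\<close> each of the \<open>m\<close> averaged terms is at
      most an \<open>m\<close>-th of it, so no positive error arises at the seam.\<close>
    have "sample_sum h q m c d g (Suc t) = 1 / m * (\<Sum>s \<in> sample_times h q m (Suc t). d * g s)"
      using 3 by (simp add: sample_sum_def sample_weight_def sum_distrib_left)
    also have "\<dots> \<le> 1 / m * (card (sample_times h q m (Suc t)) * (c * g (Suc t)))"
      by (intro mult_left_mono sum_bounded_above jump) auto
    also have "\<dots> = c * g (Suc t)"
      using weight_card_sample_times[OF assms(1,2), of h 1 1 "Suc t"] 3
      by (simp add: sample_weight_def)
    also have "\<dots> = sample_sum h q m c d (\<lambda>s. g (Suc s)) t"
      using 3 by (simp add: sample_sum_def sample_times_def sample_weight_def)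
    finally have "sample_sum h q m c d g (Suc t) - sample_sum h q m c d (\<lambda>s. g (Suc s)) t \<le> 0"
      by simp
    moreover have "0 \<le> d / m * K" using \<open>0 \<le> K\<close> assms(4) by simp
    ultimately show ?thesis by linarith
  qed
qed

text \<open>In the controllability inequality the matrix at \<open>t + 1\<close> is subtracted, so
  the shift error is needed with the opposite sign and \<open>jump\<close> is reversed.\<close>

lemma sample_sum_shift_ge:
  assumes "0 < q" "0 < m" "0 \<le> c" "0 \<le> d"
    and g: "\<And>s. s \<in> Suc ` sample_times h q m t \<union> sample_times h q m (Suc t) \<Longrightarrow> 0 \<le> g s \<and> g s \<le> K"
    and jump: "\<And>s. s \<in> sample_times h q m (Suc t) \<Longrightarrow> c * g (Suc t) \<le> d * g s"
  shows "sample_sum h q m c d (\<lambda>s. g (Suc s)) t - sample_sum h q m c d g (Suc t) \<le> d / m * K"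
proof -
  consider "h \<le> t" | "Suc t < h" | "Suc t = h" by linarith
  then show ?thesis
  proof cases
    case 1
    from mult_left_mono[OF abs_le_D2[OF sample_times_shift[OF 1 assms(1,2) g]], where c = "d / m"]
    show ?thesis
      using 1 assms(4) by (simp add: sample_sum_def sample_weight_def right_diff_distrib)
  next
    case 2
    have "0 \<le> K" using g[of "Suc t"] 2 by (auto simp: sample_times_def)
    then show ?thesis
      using 2 assms(4) by (simp add: sample_sum_def sample_times_def sample_weight_def)
  next
    case 3
    have "0 \<le> K" using g[of "Suc t"] 3 by (auto simp: sample_times_def)
    have "sample_sum h q m c d (\<lambda>s. g (Suc s)) t = c * g (Suc t)"
      using 3 by (simp add: sample_sum_def sample_times_def sample_weight_def)
    also have "\<dots> = 1 / m * (card (sample_times h q m (Suc t)) * (c * g (Suc t)))"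
      using weight_card_sample_times[OF assms(1,2), of h 1 1 "Suc t"] 3
      by (simp add: sample_weight_def)
    also have "\<dots> \<le> 1 / m * (\<Sum>s \<in> sample_times h q m (Suc t). d * g s)"
      by (intro mult_left_mono sum_bounded_below jump) auto
    also have "\<dots> = sample_sum h q m c d g (Suc t)"
      using 3 by (simp add: sample_sum_def sample_weight_def sum_distrib_left)
    finally have "sample_sum h q m c d (\<lambda>s. g (Suc s)) t - sample_sum h q m c d g (Suc t) \<le> 0"
      by simp
    moreover have "0 \<le> d / m * K" using \<open>0 \<le> K\<close> assms(4) by simp
    ultimately show ?thesis by linarith
  qed
qed

lemma qf_periodized:
  assumes "\<And>s. s \<in> sample_times h q m t \<Longrightarrow> F s \<in> carrier_mat (n t) (n t)"
    and "v \<in> carrier_vec (n t)"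
  shows "qf (periodized h q m c d n F t) v = sample_sum h q m c d (\<lambda>s. qf (F s) v) t"
  using assms by (simp add: periodized_def qf_mat_sum sample_sum_def)

lemma periodized_form_between:
  assumes "ev_periodic h q n" "0 < q" "0 < m" "0 < l" "0 < u"
    and F: "\<And>t. form_between l u (n t) (F t)" and cd: "0 < e" "e \<le> c" "e \<le> d"
  shows "form_between (e * l) ((c + d) * u) (n t) (periodized h q m c d n F t)"
proof -
  let ?S = "sample_times h q m t" and ?w = "sample_weight h m c d t"
  have "form_between l u (n t) (F s)" if "s \<in> ?S" for s
    using F[of s] ev_periodic_at_sample(1)[OF assms(1) that] by simp
  then have f: "form_between (?w * card ?S * l) (?w * card ?S * u) (n t) (periodized h q m c d n F t)"
    unfolding periodized_def using cd
    by (intro mat_sum_form_between) (auto simp: sample_weight_def)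
  show ?thesis
    by (rule form_between_mono[OF f]; unfold weight_card_sample_times[OF assms(2,3)])
      (use cd assms(4,5) in \<open>auto intro!: mult_right_mono\<close>)
qed

section \<open>Families of matrices on a graph\<close>

definition family_between ::
  "real \<Rightarrow> real \<Rightarrow> dist_system \<Rightarrow> (nat \<Rightarrow> nat \<Rightarrow> real mat) \<Rightarrow>
   (nat \<times> nat \<Rightarrow> nat \<Rightarrow> real mat) \<Rightarrow> bool" where
  "family_between l u G Z Ze \<longleftrightarrow>
     (\<forall>k \<in> verts G. \<forall>t. form_between l u (dim_x G k t) (Z k t)) \<and>
     (\<forall>e \<in> edges G. \<forall>t. form_between l u (dim_e G e t) (Ze e t))"

lemma family_between_carrier:
  assumes "family_between l u G Z Ze"
  shows "k \<in> verts G \<Longrightarrow> Z k t \<in> carrier_mat (dim_x G k t) (dim_x G k t)"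
    and "e \<in> edges G \<Longrightarrow> Ze e t \<in> carrier_mat (dim_e G e t) (dim_e G e t)"
  using assms form_betweenD(1) unfolding family_between_def by blast+

text \<open>The block-diagonal matrices of the definitions, and their dimensions, with the temporal
  block listed as \<open>None\<close> and the spatial blocks as \<open>Some e\<close>.\<close>

definition node_block ::
  "(nat \<Rightarrow> nat \<Rightarrow> real mat) \<Rightarrow> (nat \<times> nat \<Rightarrow> nat \<Rightarrow> real mat) \<Rightarrow>
   nat \<Rightarrow> (nat \<times> nat) list \<Rightarrow> nat \<Rightarrow> real mat" where
  "node_block Z Ze k es t =
     diag_block_mat (map (\<lambda>x. case_option (Z k) Ze x t) (None # map Some es))"

definition node_dim :: "dist_system \<Rightarrow> nat \<Rightarrow> (nat \<times> nat) list \<Rightarrow> nat \<Rightarrow> nat" where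
  "node_dim G k es t =
     (\<Sum>x \<leftarrow> None # map Some es. case_option (dim_x G k) (dim_e G) x t)"

definition in_edges :: "dist_system \<Rightarrow> nat \<Rightarrow> (nat \<times> nat) list" where
  "in_edges G k = map (\<lambda>i. (i, k)) (E_in G k)"

definition out_edges :: "dist_system \<Rightarrow> nat \<Rightarrow> (nat \<times> nat) list" where
  "out_edges G k = map (\<lambda>j. (k, j)) (E_out G k)"

lemma blk_eq_node_block:
  "blk_in G Z Ze k t = node_block Z Ze k (in_edges G k) t"
  "blk_out G Z Ze k t = node_block Z Ze k (out_edges G k) t"
  "dim_in G k = node_dim G k (in_edges G k)"
  "dim_out G k = node_dim G k (out_edges G k)"
  by (simp_all add: fun_eq_iff blk_in_def blk_out_def dim_in_def dim_out_def node_block_def node_dim_def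
      in_edges_def out_edges_def comp_def)

lemma set_node_edges:
  "set (in_edges G k) \<subseteq> edges G" "set (out_edges G k) \<subseteq> edges G"
  by (auto simp: in_edges_def out_edges_def E_in_def E_out_def verts_def)

lemma node_block_form_between:
  assumes "family_between l u G Z Ze" "k \<in> verts G" "set es \<subseteq> edges G"
  shows "form_between l u (node_dim G k es t) (node_block Z Ze k es t)"
  unfolding node_block_def node_dim_def
  by (rule diag_block_form_between) (use assms in \<open>auto simp: family_between_def\<close>)

lemma blk_form_between:
  assumes "family_between l u G Z Ze" "k \<in> verts G"
  shows "form_between l u (dim_in G k t) (blk_in G Z Ze k t)"
    and "form_between l u (dim_out G k t) (blk_out G Z Ze k t)"
  unfolding blk_eq_node_block
  by (rule node_block_form_between[OF assms], rule set_node_edges)+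

lemma node_block_inverse:
  assumes "family_between l u G Z Ze" "family_between l' u' G Z' Ze'"
    and "\<And>k t. k \<in> verts G \<Longrightarrow> Z k t * Z' k t = 1\<^sub>m (dim_x G k t)"
    and "\<And>e t. e \<in> edges G \<Longrightarrow> Ze e t * Ze' e t = 1\<^sub>m (dim_e G e t)"
    and "k \<in> verts G" "set es \<subseteq> edges G"
  shows "node_block Z Ze k es t * node_block Z' Ze' k es t = 1\<^sub>m (node_dim G k es t)"
  unfolding node_block_def node_dim_def
  by (rule diag_block_inverse)
    (use assms in \<open>auto dest: family_between_carrier\<close>)

lemma node_dim_ev_periodic:
  assumes "ev_periodic_system h q G" "k \<in> verts G" "set es \<subseteq> edges G"
  shows "ev_periodic h q (node_dim G k es)"
proof -
  have "ev_periodic h q (case_option (dim_x G k) (dim_e G) x)" if "x \<in> set (None # map Some es)" for x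
    using assms that by (auto simp: ev_periodic_system_def)
  then have "node_dim G k es (t + h + z * q) = node_dim G k es (t + h)" for t z
    unfolding node_dim_def by (intro arg_cong[of _ _ sum_list] map_cong) (auto simp: ev_periodic_def)
  then show ?thesis by (simp add: ev_periodic_def)
qed

text \<open>All blocks use the same times and weights, so \<open>diag_block_mat_sum\<close> applies.
  It needs each single block to have at every sample the size it has at \<open>t\<close>; this is
  where periodicity of the partition enters, beyond that of the total dimension.\<close>

lemma node_block_periodized:
  assumes per: "ev_periodic_system h q G" and Z: "family_between l u G Z Ze"
    and k: "k \<in> verts G" and es: "set es \<subseteq> edges G"
  shows "node_block (\<lambda>k. periodized h q m c d (dim_x G k) (Z k))
      (\<lambda>e. periodized h q m c d (dim_e G e) (Ze e)) k es t =
    periodized h q m c d (node_dim G k es) (node_block Z Ze k es) t"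
proof -
  let ?n = "\<lambda>x. case_option (dim_x G k) (dim_e G) x"
  let ?F = "\<lambda>x. case_option (Z k) Ze x"
  have F: "?F x s \<in> carrier_mat (?n x t) (?n x t)"
    if x: "x \<in> set (None # map Some es)" and s: "s \<in> sample_times h q m t" for x s
  proof -
    have "form_between l u (?n x s) (?F x s)"
      using Z k es x by (auto simp: family_between_def)
    then have "?F x s \<in> carrier_mat (?n x s) (?n x s)" by (rule form_betweenD(1))
    moreover have "ev_periodic h q (?n x)"
      using per k es x by (auto simp: ev_periodic_system_def)
    ultimately show ?thesis
      using ev_periodic_at_sample(1)[of h q "?n x" s m t] s by simp
  qed
  have eq: "case_option (periodized h q m c d (dim_x G k) (Z k))
        (\<lambda>e. periodized h q m c d (dim_e G e) (Ze e)) x t =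
      mat_sum (?n x t) (sample_weight h m c d t) (sample_times h q m t) (?F x)" for x
    by (cases x) (simp_all add: periodized_def)
  show ?thesis
    unfolding node_block_def eq periodized_def node_dim_def
    by (rule diag_block_mat_sum[OF F])
qed

lemma bounded_pd_family_of_periodized:
  assumes per: "ev_periodic_system h q G" and Z: "family_between l u G Z Ze"
    and "0 < q" "0 < m" "0 < l" "0 < u" "0 < e" "e \<le> c" "e \<le> d" "0 < \<beta>" "\<beta> < e * l"
  shows "bounded_pd_family G \<beta> (\<lambda>k. periodized h q m c d (dim_x G k) (Z k))
      (\<lambda>e. periodized h q m c d (dim_e G e) (Ze e))"
proof -
  have "bounded_pd_seq \<beta> n (periodized h q m c d n F)"
    if "ev_periodic h q n" "\<And>t. form_between l u (n t) (F t)" for n F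
    by (rule bounded_pd_seqI[OF periodized_form_between[OF that(1) assms(3-6) that(2) assms(7-9)]])
      (use assms in auto)
  then show ?thesis
    using per Z by (simp add: bounded_pd_family_def family_between_def ev_periodic_system_def)
qed

lemma ev_periodic_family_of_periodized:
  assumes "ev_periodic_system h q G"
  shows "ev_periodic_family h q G (\<lambda>k. periodized h q m c d (dim_x G k) (Z k))
      (\<lambda>e. periodized h q m c d (dim_e G e) (Ze e))"
  using assms by (simp add: ev_periodic_family_def ev_periodic_system_def ev_periodic_periodized)

text \<open>With the vector fixed, each matrix inequality becomes one between scalar weighted
  sums.\<close>

lemma qf_node_block_periodized:
  assumes per: "ev_periodic_system h q G" and Z: "family_between l u G Z Ze"
    and k: "k \<in> verts G" and es: "set es \<subseteq> edges G" and v: "v \<in> carrier_vec (node_dim G k es t)"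
  shows "qf (node_block (\<lambda>k. periodized h q m c d (dim_x G k) (Z k))
      (\<lambda>e. periodized h q m c d (dim_e G e) (Ze e)) k es t) v =
    sample_sum h q m c d (\<lambda>s. qf (node_block Z Ze k es s) v) t"
proof -
  have "node_block Z Ze k es s \<in> carrier_mat (node_dim G k es t) (node_dim G k es t)"
    if "s \<in> sample_times h q m t" for s
    using form_betweenD(1)[OF node_block_form_between[OF Z k es, of s]]
      ev_periodic_at_sample(1)[OF node_dim_ev_periodic[OF per k es] that] by simp
  then show ?thesis
    unfolding node_block_periodized[OF per Z k es] using v by (rule qf_periodized)
qed

lemma family_of_periodized_between:
  assumes per: "ev_periodic_system h q G" and Z: "family_between l u G Z Ze"
    and "0 < q" "0 < m" "0 < l" "0 < u" "0 < e" "e \<le> c" "e \<le> d"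
  shows "family_between (e * l) ((c + d) * u) G (\<lambda>k. periodized h q m c d (dim_x G k) (Z k))
      (\<lambda>e. periodized h q m c d (dim_e G e) (Ze e))"
  using per Z assms(3-)
  by (auto simp: family_between_def ev_periodic_system_def intro!: periodized_form_between)

section \<open>Periodic solutions of the Lyapunov inequalities\<close>

lemma periodic_observability_gramians:
  assumes q: "0 < q" and sys: "distributed_system G" and per: "ev_periodic_system h q G"
    and W: "family_between l u G W We" and l: "0 < l" "l \<le> u" and \<beta>: "0 < \<beta>"
    and lyap: "\<And>k t v. k \<in> verts G \<Longrightarrow> v \<in> carrier_vec (dim_in G k t) \<Longrightarrow>
      qf (blk_out G W We k (t + 1)) (matA G k t *\<^sub>v v) - qf (blk_in G W We k t) v \<le> - \<beta> * (v \<bullet> v)"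
    and a: "0 \<le> a" "\<And>k t v. k \<in> verts G \<Longrightarrow> v \<in> carrier_vec (dim_in G k t) \<Longrightarrow>
      (matA G k t *\<^sub>v v) \<bullet> (matA G k t *\<^sub>v v) \<le> a * (v \<bullet> v)"
    and b: "0 \<le> b" "\<And>k t v. k \<in> verts G \<Longrightarrow> v \<in> carrier_vec (dim_in G k t) \<Longrightarrow>
      (matC G k t *\<^sub>v v) \<bullet> (matC G k t *\<^sub>v v) \<le> b * (v \<bullet> v)"
  shows "\<exists>\<beta>\<^sub>0 > 0. \<exists>Y Ye. ev_periodic_family h q G Y Ye \<and>
    (\<forall>\<beta>. 0 < \<beta> \<and> \<beta> < \<beta>\<^sub>0 \<longrightarrow> observability_gramians G \<beta> Y Ye)"
proof -
  have u: "0 < u" using l by simp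
  \<comment> \<open>Makes the shift error \<open>d / m * u * a\<close> |v|^2 at most half of the
    gain d \<beta> |v|^2. The weight \<open>d\<close> cancels, so \<open>m\<close> can be fixed
    before it.\<close>
  obtain m :: nat where m: "2 * u * a / \<beta> < m"
    using reals_Archimedean2 by blast
  have "0 < m" using m u a(1) \<beta> by (cases m) (auto simp: divide_less_0_iff mult_less_0_iff)
  \<comment> \<open>Then d \<beta> = 2 (b + 1): one half absorbs the shift error, the other covers
    the bound \<open>b\<close> on the output term and leaves a decrease of 1.\<close>
  define d where "d = 2 * (b + 1) / \<beta>"
  \<comment> \<open>Since \<open>c l = d u\<close>, the smallest possible value with weight
    \<open>c\<close> matches the largest with weight \<open>d\<close>, as the seam demands.\<close>
  define c where "c = d * u / l"
  have d: "0 < d" using b(1) \<beta> by (simp add: d_def)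
  have dc: "d \<le> c" using d l by (simp add: c_def field_simps)
  define Y where "Y = (\<lambda>k. periodized h q m c d (dim_x G k) (W k))"
  define Ye where "Ye = (\<lambda>e. periodized h q m c d (dim_e G e) (We e))"
  have Y: "family_between (d * l) ((c + d) * u) G Y Ye"
    unfolding Y_def Ye_def using d dc l u q \<open>0 < m\<close>
    by (intro family_of_periodized_between[OF per W]) auto
  \<comment> \<open>The 1 is the decrease left over below; \<open>d l\<close> is the lower bound on
    the blocks of \<open>Y\<close> and \<open>Ye\<close>.\<close>
  have "observability_gramians G \<gamma> Y Ye" if \<gamma>: "0 < \<gamma>" "\<gamma> < min 1 (d * l)" for \<gamma>
    unfolding observability_gramians_def
  proof (intro conjI allI ballI)
    show "bounded_pd_family G \<gamma> Y Ye"
      unfolding Y_def Ye_def using d dc l u q \<gamma> \<open>0 < m\<close>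
      by (intro bounded_pd_family_of_periodized[OF per W, where e = d]) auto
    fix t k assume k: "k \<in> verts G"
    let ?A = "matA G k t" and ?C = "matC G k t"
    have A: "?A \<in> carrier_mat (dim_out G k (Suc t)) (dim_in G k t)"
      and C: "?C \<in> carrier_mat (dim_y G k t) (dim_in G k t)"
      using sys k by (auto simp: distributed_system_def)
    have perA: "ev_periodic h q (matA G k)"
      using per k by (simp add: ev_periodic_system_def)
    note fbi = blk_form_between(1)[OF _ k] and fbo = blk_form_between(2)[OF _ k]
    note pdi = node_dim_ev_periodic[OF per k set_node_edges(1)[of G k], folded blk_eq_node_block]
      and pdo = node_dim_ev_periodic[OF per k set_node_edges(2)[of G k], folded blk_eq_node_block]
    note L = Lyapunov_expression[OF A form_betweenD(1,2)[OF fbo[OF Y]]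
        form_betweenD(1,2)[OF fbi[OF Y]] C]
    show "transpose_mat ?A * blk_out G Y Ye k (t + 1) * ?A - blk_in G Y Ye k t
        + transpose_mat ?C * ?C \<prec>\<^sub>L (- \<gamma>) \<cdot>\<^sub>m 1\<^sub>m (dim_in G k t)"
    proof (rule loewner_less_negI)
      show "\<gamma> < 1" using \<gamma> by simp
      fix v :: "real vec" assume v: "v \<in> carrier_vec (dim_in G k t)"
      define w where "w = ?A *\<^sub>v v"
      define \<nu> where "\<nu> = v \<bullet> v"
      have w: "w \<in> carrier_vec (dim_out G k (Suc t))" using A v by (simp add: w_def)
      have \<nu>: "0 \<le> \<nu>" by (simp add: \<nu>_def self_scalar_ge_0)
      \<comment> \<open>The shifted forms are evaluated at \<open>A v\<close>, so the shift error is
        controlled through the norm of \<open>A\<close>.\<close>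
      have wa: "w \<bullet> w \<le> a * \<nu>" using a(2)[OF k v] by (simp add: w_def \<nu>_def)
      define f where "f = (\<lambda>s. qf (blk_in G W We k s) v)"
      define g where "g = (\<lambda>s. qf (blk_out G W We k s) w)"
      have qY: "qf (blk_out G Y Ye k (Suc t)) w = sample_sum h q m c d g (Suc t)"
        "qf (blk_in G Y Ye k t) v = sample_sum h q m c d f t"
        using qf_node_block_periodized[OF per W k set_node_edges(2)] w
          qf_node_block_periodized[OF per W k set_node_edges(1)] v
        by (simp_all add: g_def f_def Y_def Ye_def blk_eq_node_block)
      have g_bounds: "l * (w \<bullet> w) \<le> g s" "g s \<le> u * (w \<bullet> w)"
        if "s \<in> Suc ` sample_times h q m t \<union> sample_times h q m (Suc t)" for s
      proof -
        have "dim_out G k s = dim_out G k (Suc t)"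
          using that ev_periodic_at_sample[OF pdo] by blast
        then show "l * (w \<bullet> w) \<le> g s" "g s \<le> u * (w \<bullet> w)"
          using form_betweenD(3,4)[OF fbo[OF W]] w by (simp_all add: g_def)
      qed
      have g_in: "0 \<le> g s \<and> g s \<le> u * (a * \<nu>)"
        if "s \<in> Suc ` sample_times h q m t \<union> sample_times h q m (Suc t)" for s
        using g_bounds[OF that] mult_nonneg_nonneg[OF less_imp_le[OF l(1)] self_scalar_ge_0[of w]]
          mult_left_mono[OF wa less_imp_le[OF u]] by linarith
      have s1: "sample_sum h q m c d g (Suc t) - sample_sum h q m c d (\<lambda>s. g (Suc s)) t
          \<le> d / m * (u * (a * \<nu>))"
      proof (rule sample_sum_shift_le[OF q \<open>0 < m\<close> _ _ g_in])
        fix s assume s: "s \<in> sample_times h q m (Suc t)"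
        have "l * (w \<bullet> w) \<le> g (Suc t)"
          using form_betweenD(3)[OF fbo[OF W]] w by (simp add: g_def)
        then have "c * (l * (w \<bullet> w)) \<le> c * g (Suc t)"
          using d dc by (intro mult_left_mono) auto
        moreover have "d * g s \<le> d * (u * (w \<bullet> w))"
          using g_bounds(2)[of s] s d by (intro mult_left_mono) auto
        moreover have "c * (l * (w \<bullet> w)) = d * (u * (w \<bullet> w))"
          using l by (simp add: c_def)
        ultimately show "d * g s \<le> c * g (Suc t)" by simp
      qed (use d dc in auto)
      have s2: "sample_sum h q m c d (\<lambda>s. g (Suc s)) t - sample_sum h q m c d f t
          \<le> - d * (\<beta> * \<nu>)"
      proof (rule sample_sum_mono_gap[OF q \<open>0 < m\<close>])
        fix s assume s: "s \<in> sample_times h q m t"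
        \<comment> \<open>All samples have the same \<open>A\<close>, so the single vector
          \<open>w = A v\<close> serves every sampled inequality.\<close>
        have "matA G k s = ?A" "dim_in G k s = dim_in G k t"
          using ev_periodic_at_sample(1)[OF perA s] ev_periodic_at_sample(1)[OF pdi s] by auto
        then show "g (Suc s) - f s \<le> - (\<beta> * \<nu>)"
          using lyap[OF k, of v s] v by (simp add: g_def f_def w_def \<nu>_def)
      qed (use d dc \<beta> \<nu> in auto)
      have s3: "d / m * (u * (a * \<nu>)) \<le> d * (\<beta> * \<nu>) / 2"
      proof -
        have "u * a / m \<le> \<beta> / 2" using m \<open>0 < m\<close> \<beta> by (simp add: field_simps)
        then have "d * \<nu> * (u * a / m) \<le> d * \<nu> * (\<beta> / 2)"
          using d \<nu> by (intro mult_left_mono) auto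
        then show ?thesis by (simp add: field_simps)
      qed
      have s4: "d * (\<beta> * \<nu>) = 2 * (b * \<nu> + \<nu>)"
        using \<beta> by (simp add: d_def field_simps)
      have "sample_sum h q m c d g (Suc t) - sample_sum h q m c d (\<lambda>s. g (Suc s)) t \<le> b * \<nu> + \<nu>"
        using order_trans[OF s1 s3] s4 by simp
      moreover have "sample_sum h q m c d (\<lambda>s. g (Suc s)) t - sample_sum h q m c d f t \<le> - (2 * (b * \<nu>)) - 2 * \<nu>"
        using s2 s4 by simp
      moreover have "(?C *\<^sub>v v) \<bullet> (?C *\<^sub>v v) \<le> b * \<nu>" using b(2)[OF k v] by (simp add: \<nu>_def)
      ultimately have "sample_sum h q m c d g (Suc t) - sample_sum h q m c d f t
          + (?C *\<^sub>v v) \<bullet> (?C *\<^sub>v v) \<le> - \<nu>"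
        by linarith
      then show "qf (transpose_mat ?A * blk_out G Y Ye k (t + 1) * ?A - blk_in G Y Ye k t
          + transpose_mat ?C * ?C) v \<le> - 1 * (v \<bullet> v)"
        using L(3)[OF v] qY by (simp add: w_def[symmetric] \<nu>_def)
    qed (use L in simp_all)
  qed
  moreover have "ev_periodic_family h q G Y Ye"
    unfolding Y_def Ye_def by (rule ev_periodic_family_of_periodized[OF per])
  moreover have "0 < min 1 (d * l)" using d l by simp
  ultimately show ?thesis by blast
qed

text \<open>The forms whose samples are shifted now belong to the subtracted matrix and are
  evaluated at \<open>v\<close> itself. The seam requires the averaged part to carry the larger
  weight, so the shift error is enlarged by the ratio of the bounds.\<close>

lemma periodic_controllability_gramians:
  assumes q: "0 < q" and sys: "distributed_system G" and per: "ev_periodic_system h q G"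
    and V: "family_between l u G V Ve" and l: "0 < l" "l \<le> u" and \<beta>: "0 < \<beta>"
    and lyap: "\<And>k t v. k \<in> verts G \<Longrightarrow> v \<in> carrier_vec (dim_out G k (t + 1)) \<Longrightarrow>
      qf (blk_in G V Ve k t) (transpose_mat (matA G k t) *\<^sub>v v) - qf (blk_out G V Ve k (t + 1)) v
        \<le> - \<beta> * (v \<bullet> v)"
    and b: "0 \<le> b" "\<And>k t v. k \<in> verts G \<Longrightarrow> v \<in> carrier_vec (dim_out G k (t + 1)) \<Longrightarrow>
      (transpose_mat (matB G k t) *\<^sub>v v) \<bullet> (transpose_mat (matB G k t) *\<^sub>v v) \<le> b * (v \<bullet> v)"
  shows "\<exists>\<beta>\<^sub>0 > 0. \<exists>X Xe. ev_periodic_family h q G X Xe \<and>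
    (\<forall>\<beta>. 0 < \<beta> \<and> \<beta> < \<beta>\<^sub>0 \<longrightarrow> controllability_gramians G \<beta> X Xe)"
proof -
  have u: "0 < u" using l by simp
  \<comment> \<open>The shift error carries the weight \<open>d = c u / l\<close>, while the
    guaranteed gain carries only \<open>c\<close>. This puts the extra ratio u / l into the bound on
    \<open>m\<close>.\<close>
  obtain m :: nat where m: "2 * u * u / (l * \<beta>) < m"
    using reals_Archimedean2 by blast
  have "0 < m" using m u l \<beta> by (cases m) (auto simp: divide_less_0_iff mult_less_0_iff)
  \<comment> \<open>The smaller weight determines the gain: c \<beta> = 2 (b + 1) is shared between
    the shift error, the input term and a decrease of 1.\<close>
  define c where "c = 2 * (b + 1) / \<beta>"
  define d where "d = c * u / l"
  have c: "0 < c" using b(1) \<beta> by (simp add: c_def)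
  have cd: "c \<le> d" using c l by (simp add: d_def field_simps)
  define X where "X = (\<lambda>k. periodized h q m c d (dim_x G k) (V k))"
  define Xe where "Xe = (\<lambda>e. periodized h q m c d (dim_e G e) (Ve e))"
  have X: "family_between (c * l) ((c + d) * u) G X Xe"
    unfolding X_def Xe_def using c cd l u q \<open>0 < m\<close>
    by (intro family_of_periodized_between[OF per V]) auto
  have "controllability_gramians G \<gamma> X Xe" if \<gamma>: "0 < \<gamma>" "\<gamma> < min 1 (c * l)" for \<gamma>
    unfolding controllability_gramians_def
  proof (intro conjI allI ballI)
    show "bounded_pd_family G \<gamma> X Xe"
      unfolding X_def Xe_def using c cd l u q \<gamma> \<open>0 < m\<close>
      by (intro bounded_pd_family_of_periodized[OF per V, where e = c]) auto
    fix t k assume k: "k \<in> verts G"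
    let ?A = "matA G k t" and ?B = "matB G k t"
    have A: "transpose_mat ?A \<in> carrier_mat (dim_in G k t) (dim_out G k (Suc t))"
      and B: "transpose_mat ?B \<in> carrier_mat (dim_u G k t) (dim_out G k (Suc t))"
      using sys k by (auto simp: distributed_system_def)
    have perA: "ev_periodic h q (matA G k)"
      using per k by (simp add: ev_periodic_system_def)
    note fbi = blk_form_between(1)[OF _ k] and fbo = blk_form_between(2)[OF _ k]
    note pdo = node_dim_ev_periodic[OF per k set_node_edges(2)[of G k], folded blk_eq_node_block]
    note L = Lyapunov_expression[OF A form_betweenD(1,2)[OF fbi[OF X]]
        form_betweenD(1,2)[OF fbo[OF X]] B, unfolded transpose_transpose]
    show "?A * blk_in G X Xe k t * transpose_mat ?A - blk_out G X Xe k (t + 1)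
        + ?B * transpose_mat ?B \<prec>\<^sub>L (- \<gamma>) \<cdot>\<^sub>m 1\<^sub>m (dim_out G k (t + 1))"
    proof (rule loewner_less_negI)
      show "\<gamma> < 1" using \<gamma> by simp
      fix v :: "real vec" assume v': "v \<in> carrier_vec (dim_out G k (t + 1))"
      then have v: "v \<in> carrier_vec (dim_out G k (Suc t))" by simp
      define w where "w = transpose_mat ?A *\<^sub>v v"
      define \<nu> where "\<nu> = v \<bullet> v"
      have w: "w \<in> carrier_vec (dim_in G k t)" using A v by (simp add: w_def)
      have \<nu>: "0 \<le> \<nu>" by (simp add: \<nu>_def self_scalar_ge_0)
      define f where "f = (\<lambda>s. qf (blk_in G V Ve k s) w)"
      define g where "g = (\<lambda>s. qf (blk_out G V Ve k s) v)"
      have qX: "qf (blk_out G X Xe k (Suc t)) v = sample_sum h q m c d g (Suc t)"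
        "qf (blk_in G X Xe k t) w = sample_sum h q m c d f t"
        using qf_node_block_periodized[OF per V k set_node_edges(2)] v
          qf_node_block_periodized[OF per V k set_node_edges(1)] w
        by (simp_all add: g_def f_def X_def Xe_def blk_eq_node_block)
      have dims: "dim_out G k s = dim_out G k (Suc t)"
        if "s \<in> Suc ` sample_times h q m t \<union> sample_times h q m (Suc t)" for s
        using that ev_periodic_at_sample[OF pdo] by blast
      have g_bounds: "l * \<nu> \<le> g s" "g s \<le> u * \<nu>"
        if "s \<in> Suc ` sample_times h q m t \<union> sample_times h q m (Suc t)" for s
        using form_betweenD(3,4)[OF fbo[OF V, of s]] v dims[OF that] by (simp_all add: g_def \<nu>_def)
      have g_in: "0 \<le> g s \<and> g s \<le> u * \<nu>"
        if "s \<in> Suc ` sample_times h q m t \<union> sample_times h q m (Suc t)" for s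
        using g_bounds[OF that] mult_nonneg_nonneg[OF less_imp_le[OF l(1)] \<nu>] by linarith
      have s1: "sample_sum h q m c d (\<lambda>s. g (Suc s)) t - sample_sum h q m c d g (Suc t)
          \<le> d / m * (u * \<nu>)"
      proof (rule sample_sum_shift_ge[OF q \<open>0 < m\<close> _ _ g_in])
        fix s assume s: "s \<in> sample_times h q m (Suc t)"
        have "g (Suc t) \<le> u * \<nu>"
          using form_betweenD(4)[OF fbo[OF V]] v by (simp add: g_def \<nu>_def)
        then have "c * g (Suc t) \<le> c * (u * \<nu>)"
          using c by (intro mult_left_mono) auto
        moreover have "d * (l * \<nu>) \<le> d * g s"
          using g_bounds(1)[of s] s c cd by (intro mult_left_mono) auto
        moreover have "d * (l * \<nu>) = c * (u * \<nu>)"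
          using l by (simp add: d_def)
        ultimately show "c * g (Suc t) \<le> d * g s" by simp
      qed (use c cd in auto)
      have s2: "sample_sum h q m c d f t - sample_sum h q m c d (\<lambda>s. g (Suc s)) t
          \<le> - c * (\<beta> * \<nu>)"
      proof (rule sample_sum_mono_gap[OF q \<open>0 < m\<close>])
        fix s assume s: "s \<in> sample_times h q m t"
        have "matA G k s = ?A" "dim_out G k (Suc s) = dim_out G k (Suc t)"
          using ev_periodic_at_sample(1)[OF perA s] ev_periodic_at_sample(2)[OF pdo s] by auto
        then show "f s - g (Suc s) \<le> - (\<beta> * \<nu>)"
          using lyap[OF k, of v s] v by (simp add: g_def f_def w_def \<nu>_def)
      qed (use c cd \<beta> \<nu> in auto)
      have s3: "d / m * (u * \<nu>) \<le> c * (\<beta> * \<nu>) / 2"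
      proof -
        have "u * u / (l * m) \<le> \<beta> / 2" using m \<open>0 < m\<close> \<beta> l by (simp add: field_simps)
        then have "c * \<nu> * (u * u / (l * m)) \<le> c * \<nu> * (\<beta> / 2)"
          using c \<nu> by (intro mult_left_mono) auto
        then show ?thesis by (simp add: d_def field_simps)
      qed
      have s4: "c * (\<beta> * \<nu>) = 2 * (b * \<nu> + \<nu>)"
        using \<beta> by (simp add: c_def field_simps)
      have "sample_sum h q m c d (\<lambda>s. g (Suc s)) t - sample_sum h q m c d g (Suc t) \<le> b * \<nu> + \<nu>"
        using order_trans[OF s1 s3] s4 by simp
      moreover have "sample_sum h q m c d f t - sample_sum h q m c d (\<lambda>s. g (Suc s)) t \<le> - (2 * (b * \<nu>)) - 2 * \<nu>"
        using s2 s4 by simp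
      moreover have "(transpose_mat ?B *\<^sub>v v) \<bullet> (transpose_mat ?B *\<^sub>v v) \<le> b * \<nu>"
        using b(2)[OF k v'] by (simp add: \<nu>_def)
      ultimately have "sample_sum h q m c d f t - sample_sum h q m c d g (Suc t)
          + (transpose_mat ?B *\<^sub>v v) \<bullet> (transpose_mat ?B *\<^sub>v v) \<le> - \<nu>"
        by linarith
      then show "qf (?A * blk_in G X Xe k t * transpose_mat ?A - blk_out G X Xe k (t + 1)
          + ?B * transpose_mat ?B) v \<le> - 1 * (v \<bullet> v)"
        using L(3)[OF v] qX by (simp add: w_def[symmetric] \<nu>_def)
    qed (use L in simp_all)
  qed
  moreover have "ev_periodic_family h q G X Xe"
    unfolding X_def Xe_def by (rule ev_periodic_family_of_periodized[OF per])
  moreover have "0 < min 1 (c * l)" using c l by simp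
  ultimately show ?thesis by blast
qed

section \<open>Uniform constants over a finite graph, inverse families and the final
  assembly\<close>

lemma finite_uniform_bound:
  fixes c\<^sub>0 :: real
  assumes "finite S" "\<And>x. x \<in> S \<Longrightarrow> \<exists>c. P x c" "\<And>x c c'. P x c \<Longrightarrow> c \<le> c' \<Longrightarrow> P x c'"
  shows "\<exists>c \<ge> c\<^sub>0. \<forall>x \<in> S. P x c"
proof -
  obtain C where C: "\<And>x. x \<in> S \<Longrightarrow> P x (C x)" using assms(2) by metis
  have "C x \<le> Max (insert c\<^sub>0 (C ` S))" if "x \<in> S" for x
    using that assms(1) by (intro Max_ge) auto
  moreover have "c\<^sub>0 \<le> Max (insert c\<^sub>0 (C ` S))"
    using assms(1) by (intro Max_ge) auto
  ultimately show ?thesis using assms(3) C by blast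
qed

text \<open>Finitely many vertices and edges allow one common upper bound. The prescribed
  \<open>c\<close> lets it be taken at least as large as the lower bound.\<close>

lemma bounded_pd_family_between:
  assumes "edges G \<subseteq> verts G \<times> verts G" "bounded_pd_family G \<beta> W We"
  shows "\<exists>u \<ge> c. family_between \<beta> u G W We"
proof -
  have fin: "finite (verts G)" by (simp add: verts_def)
  then have fin_e: "finite (edges G)" using assms(1) finite_subset by blast
  have "\<exists>u \<ge> c. \<forall>k \<in> verts G. \<forall>t. form_between \<beta> u (dim_x G k t) (W k t)"
  proof (rule finite_uniform_bound[OF fin])
    show "\<exists>u. \<forall>t. form_between \<beta> u (dim_x G k t) (W k t)" if "k \<in> verts G" for k
      using assms(2) that by (intro bounded_pd_seqD) (simp add: bounded_pd_family_def)
  qed (use form_between_mono in blast)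
  then obtain u\<^sub>1 where u\<^sub>1: "\<forall>k \<in> verts G. \<forall>t. form_between \<beta> u\<^sub>1 (dim_x G k t) (W k t)"
    by blast
  have "\<exists>u \<ge> c. \<forall>e \<in> edges G. \<forall>t. form_between \<beta> u (dim_e G e t) (We e t)"
  proof (rule finite_uniform_bound[OF fin_e])
    show "\<exists>u. \<forall>t. form_between \<beta> u (dim_e G e t) (We e t)" if "e \<in> edges G" for e
      using assms(2) that by (intro bounded_pd_seqD) (simp add: bounded_pd_family_def)
  qed (use form_between_mono in blast)
  then obtain u\<^sub>2 where u\<^sub>2: "\<forall>e \<in> edges G. \<forall>t. form_between \<beta> u\<^sub>2 (dim_e G e t) (We e t)"
    by blast
  have "family_between \<beta> (max c (max u\<^sub>1 u\<^sub>2)) G W We"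
    by (auto simp: family_between_def intro: form_between_mono[OF u\<^sub>1[rule_format] order_refl]
        form_between_mono[OF u\<^sub>2[rule_format] order_refl])
  then show ?thesis by (intro exI[of _ "max c (max u\<^sub>1 u\<^sub>2)"]) simp
qed

lemma uniformly_bounded_family:
  assumes "finite S" "\<And>k. k \<in> S \<Longrightarrow> uniformly_bounded (M k)"
    and M: "\<And>k t. k \<in> S \<Longrightarrow> M k t \<in> carrier_mat (p k t) (n k t)"
  obtains a where "0 \<le> a" "\<And>k t v. k \<in> S \<Longrightarrow> v \<in> carrier_vec (n k t) \<Longrightarrow>
    (M k t *\<^sub>v v) \<bullet> (M k t *\<^sub>v v) \<le> a * (v \<bullet> v)"
proof -
  let ?P = "\<lambda>k a. \<forall>t. \<forall>v \<in> carrier_vec (n k t). (M k t *\<^sub>v v) \<bullet> (M k t *\<^sub>v v) \<le> a * (v \<bullet> v)"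
  have "\<exists>a \<ge> 0. \<forall>k \<in> S. ?P k a"
  proof (rule finite_uniform_bound[OF assms(1)])
    show "\<exists>a. ?P k a" if "k \<in> S" for k
      using uniformly_boundedD[OF assms(2)[OF that]] carrier_matD(2)[OF M[OF that]] by auto
    show "?P k c'" if "?P k c" "c \<le> c'" for k c c'
      using that mult_right_mono[OF \<open>c \<le> c'\<close> self_scalar_ge_0] by (meson order_trans)
  qed
  then show thesis using that by blast
qed

text \<open>A matrix and its transpose have the same operator norm: |w|^2 = v . B w for the vector
  \<open>w\<close> below, and Cauchy-Schwarz allows |w|^2 to be cancelled. Boundedness is given for
  \<open>B\<close>, but controllability involves its transpose.\<close>

lemma transpose_bound:
  fixes B :: "real mat"
  assumes B: "B \<in> carrier_mat p r" and v: "v \<in> carrier_vec p"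
    and b: "0 \<le> b" "\<And>w. w \<in> carrier_vec r \<Longrightarrow> (B *\<^sub>v w) \<bullet> (B *\<^sub>v w) \<le> b * (w \<bullet> w)"
  shows "(transpose_mat B *\<^sub>v v) \<bullet> (transpose_mat B *\<^sub>v v) \<le> b * (v \<bullet> v)"
proof -
  define w where "w = transpose_mat B *\<^sub>v v"
  have w: "w \<in> carrier_vec r" and Bw: "B *\<^sub>v w \<in> carrier_vec p"
    using B v by (auto simp: w_def)
  have "w \<bullet> w = v \<bullet> (B *\<^sub>v w)"
    using transpose_vec_mult_scalar[OF B w v] by (simp add: w_def)
  then have "(w \<bullet> w)\<^sup>2 \<le> (v \<bullet> v) * ((B *\<^sub>v w) \<bullet> (B *\<^sub>v w))"
    using Cauchy_Schwarz_vec[OF v Bw] by simp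
  also have "\<dots> \<le> (v \<bullet> v) * (b * (w \<bullet> w))"
    by (intro mult_left_mono b w self_scalar_ge_0)
  finally have "(w \<bullet> w) * (w \<bullet> w) \<le> (w \<bullet> w) * (b * (v \<bullet> v))"
    by (simp add: power2_eq_square algebra_simps)
  then have "w \<bullet> w \<le> b * (v \<bullet> v)"
    using self_scalar_ge_0[of w] self_scalar_ge_0[of v] b(1) by (cases "w \<bullet> w = 0") auto
  then show ?thesis by (simp add: w_def)
qed

text \<open>The bounds on an inverse depend only on \<open>l\<close> and \<open>u\<close>, so
  inverses chosen separately at each index and time are still uniformly bounded.\<close>

lemma family_inverse:
  assumes W: "family_between l u G W We" and "0 < l" "0 < u"
  obtains V Ve where "family_between (1 / u) (1 / l) G V Ve"
    and "\<And>k t. k \<in> verts G \<Longrightarrow> W k t * V k t = 1\<^sub>m (dim_x G k t)"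
    and "\<And>e t. e \<in> edges G \<Longrightarrow> We e t * Ve e t = 1\<^sub>m (dim_e G e t)"
proof -
  define V where "V = (\<lambda>k t. SOME N.
    form_between (1 / u) (1 / l) (dim_x G k t) N \<and> W k t * N = 1\<^sub>m (dim_x G k t))"
  define Ve where "Ve = (\<lambda>e t. SOME N.
    form_between (1 / u) (1 / l) (dim_e G e t) N \<and> We e t * N = 1\<^sub>m (dim_e G e t))"
  have V: "form_between (1 / u) (1 / l) (dim_x G k t) (V k t) \<and> W k t * V k t = 1\<^sub>m (dim_x G k t)"
    if "k \<in> verts G" for k t
    unfolding V_def
    by (rule someI_ex, rule form_between_inverse) (use that assms in \<open>auto simp: family_between_def\<close>)
  have Ve: "form_between (1 / u) (1 / l) (dim_e G e t) (Ve e t) \<and> We e t * Ve e t = 1\<^sub>m (dim_e G e t)"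
    if "e \<in> edges G" for e t
    unfolding Ve_def
    by (rule someI_ex, rule form_between_inverse) (use that assms in \<open>auto simp: family_between_def\<close>)
  show thesis
    using V Ve by (intro that[of V Ve]) (auto simp: family_between_def)
qed

theorem theorem4:
  fixes h q :: nat and G :: dist_system
  assumes "q > 0"
    and "distributed_system G"
    and "strongly_stable G"
    and "ev_periodic_system h q G"
  shows "\<exists>\<beta> > 0. \<exists>X Xe Y Ye.
           controllability_gramians G \<beta> X Xe \<and> ev_periodic_family h q G X Xe \<and>
           observability_gramians G \<beta> Y Ye \<and> ev_periodic_family h q G Y Ye"
proof -
  have sys: "edges G \<subseteq> verts G \<times> verts G"
    "\<And>k t. k \<in> verts G \<Longrightarrow> matA G k t \<in> carrier_mat (dim_out G k (t + 1)) (dim_in G k t)"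
    "\<And>k t. k \<in> verts G \<Longrightarrow> matB G k t \<in> carrier_mat (dim_out G k (t + 1)) (dim_u G k t)"
    "\<And>k t. k \<in> verts G \<Longrightarrow> matC G k t \<in> carrier_mat (dim_y G k t) (dim_in G k t)"
    "\<And>k. k \<in> verts G \<Longrightarrow> uniformly_bounded (matA G k)"
    "\<And>k. k \<in> verts G \<Longrightarrow> uniformly_bounded (matB G k)"
    "\<And>k. k \<in> verts G \<Longrightarrow> uniformly_bounded (matC G k)"
    using assms(2) unfolding distributed_system_def by auto
  have fin: "finite (verts G)" by (simp add: verts_def)
  obtain a where a: "0 \<le> a" "\<And>k t v. k \<in> verts G \<Longrightarrow> v \<in> carrier_vec (dim_in G k t) \<Longrightarrow>
      (matA G k t *\<^sub>v v) \<bullet> (matA G k t *\<^sub>v v) \<le> a * (v \<bullet> v)"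
    using uniformly_bounded_family[where M = "matA G", OF fin sys(5) sys(2)] by blast
  obtain b where b: "0 \<le> b" "\<And>k t v. k \<in> verts G \<Longrightarrow> v \<in> carrier_vec (dim_u G k t) \<Longrightarrow>
      (matB G k t *\<^sub>v v) \<bullet> (matB G k t *\<^sub>v v) \<le> b * (v \<bullet> v)"
    using uniformly_bounded_family[where M = "matB G", OF fin sys(6) sys(3)] by blast
  obtain c where c: "0 \<le> c" "\<And>k t v. k \<in> verts G \<Longrightarrow> v \<in> carrier_vec (dim_in G k t) \<Longrightarrow>
      (matC G k t *\<^sub>v v) \<bullet> (matC G k t *\<^sub>v v) \<le> c * (v \<bullet> v)"
    using uniformly_bounded_family[where M = "matC G", OF fin sys(7) sys(4)] by blast
  obtain \<beta> W We where \<beta>: "0 < \<beta>" and pd: "bounded_pd_family G \<beta> W We"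
    and stable: "\<And>t k. k \<in> verts G \<Longrightarrow>
      transpose_mat (matA G k t) * blk_out G W We k (t + 1) * matA G k t - blk_in G W We k t
        \<prec>\<^sub>L (- \<beta>) \<cdot>\<^sub>m 1\<^sub>m (dim_in G k t)"
    using assms(3) unfolding strongly_stable_def by blast
  \<comment> \<open>\<beta> is both the lower bound on the blocks and the decrease, so \<beta> \<le>
    u provides the ordering of the bounds and the nonnegative contraction factor in
    \<open>dual_Lyapunov\<close>.\<close>
  obtain u where u: "\<beta> \<le> u" and W: "family_between \<beta> u G W We"
    using bounded_pd_family_between[OF sys(1) pd, of \<beta>] by blast
  have u0: "0 < u" using u \<beta> by simp
  note fbi = blk_form_between(1) and fbo = blk_form_between(2)
  have lyap: "qf (blk_out G W We k (t + 1)) (matA G k t *\<^sub>v v) - qf (blk_in G W We k t) v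
      \<le> - \<beta> * (v \<bullet> v)"
    if k: "k \<in> verts G" and v: "v \<in> carrier_vec (dim_in G k t)" for k t v
  proof -
    note I = form_betweenD(1)[OF fbi[OF W k, of t]] and O = form_betweenD(1)[OF fbo[OF W k, of "t + 1"]]
    have c: "transpose_mat (matA G k t) * blk_out G W We k (t + 1) * matA G k t
        \<in> carrier_mat (dim_in G k t) (dim_in G k t)"
      using sys(2)[OF k, of t] O by auto
    show ?thesis
      using loewner_less_negD[OF minus_carrier_mat[OF I] stable[OF k] v]
      unfolding qf_minus[OF c I v] qf_congruence[OF sys(2)[OF k] O v] .
  qed
  obtain V Ve where V: "family_between (1 / u) (1 / \<beta>) G V Ve"
    and WV: "\<And>k t. k \<in> verts G \<Longrightarrow> W k t * V k t = 1\<^sub>m (dim_x G k t)"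
    and WVe: "\<And>e t. e \<in> edges G \<Longrightarrow> We e t * Ve e t = 1\<^sub>m (dim_e G e t)"
    using family_inverse[OF W \<beta> u0] by blast
  \<comment> \<open>Inversion block by block inverts the assembled matrices, so the dual solution
    again has the structure of the graph.\<close>
  have inv_in: "blk_in G W We k t * blk_in G V Ve k t = 1\<^sub>m (dim_in G k t)"
    and inv_out: "blk_out G W We k t * blk_out G V Ve k t = 1\<^sub>m (dim_out G k t)"
    if "k \<in> verts G" for k t
    unfolding blk_eq_node_block
    by (rule node_block_inverse[OF W V WV WVe that], assumption+, rule set_node_edges)+
  have dual: "qf (blk_in G V Ve k t) (transpose_mat (matA G k t) *\<^sub>v v)
      - qf (blk_out G V Ve k (t + 1)) v \<le> - (\<beta> / u\<^sup>2) * (v \<bullet> v)"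
    if k: "k \<in> verts G" and v: "v \<in> carrier_vec (dim_out G k (t + 1))" for k t v
    by (rule dual_Lyapunov[OF sys(2)[OF k] fbo[OF W k] fbi[OF W k] fbo[OF V k] inv_out[OF k]
          fbi[OF V k] inv_in[OF k] \<beta> u0 \<beta> u lyap[OF k] v])
  obtain \<beta>\<^sub>1 Y Ye where Y: "0 < \<beta>\<^sub>1" "ev_periodic_family h q G Y Ye"
    "\<And>\<beta>. 0 < \<beta> \<Longrightarrow> \<beta> < \<beta>\<^sub>1 \<Longrightarrow> observability_gramians G \<beta> Y Ye"
    using periodic_observability_gramians[OF assms(1,2,4) W \<beta> u \<beta> lyap a c] by blast
  have "1 / u \<le> 1 / \<beta>" using u \<beta> by (simp add: frac_le)
  moreover have "(transpose_mat (matB G k t) *\<^sub>v v) \<bullet> (transpose_mat (matB G k t) *\<^sub>v v) \<le> b * (v \<bullet> v)"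
    if "k \<in> verts G" "v \<in> carrier_vec (dim_out G k (t + 1))" for k t v
    by (rule transpose_bound[OF sys(3)[OF that(1)] that(2) b(1) b(2)[OF that(1)]])
  ultimately obtain \<beta>\<^sub>2 X Xe where X: "0 < \<beta>\<^sub>2" "ev_periodic_family h q G X Xe"
    "\<And>\<beta>. 0 < \<beta> \<Longrightarrow> \<beta> < \<beta>\<^sub>2 \<Longrightarrow> controllability_gramians G \<beta> X Xe"
    using periodic_controllability_gramians[OF assms(1,2,4) V _ _ _ dual b(1)] u0 \<beta> by fastforce
  \<comment> \<open>Each family is admissible for every constant below its own threshold, so half of
    the smaller threshold serves both.\<close>
  let ?\<beta> = "min \<beta>\<^sub>1 \<beta>\<^sub>2 / 2"
  have "0 < ?\<beta>" "?\<beta> < \<beta>\<^sub>1" "?\<beta> < \<beta>\<^sub>2" using X(1) Y(1) by auto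
  then show ?thesis using X(2,3) Y(2,3) by blast
qed

end
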